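(* Let $T=(1,2,\ldots,d,t,0)$ with $d\ge t\ge1$, $s=d+1-t$, and $\delta=\max\{t+1-s,0\}$. Let $k$ be an integer with $s+\delta<k\le s+t$. Then the number of partitions $P$ of diagonal lengths $T$ with $\kappa(P)\ge k$ is $$\binom{s+t}{k}.$$ In particular, the number of special partitions of diagonal lengths $T$ is $$\binom{s+t}{s+\delta+1}=\binom{s+t}{\min\{s-2,\,t-1\}},$$ and the number of non-special partitions of diagonal lengths $T$ is $$\binom{s+t}{s}-\binom{s+t}{s+\delta+1}.$$
   Context: Binomial coefficients $\binom{a}{b}$ with $b<0$ or $b>a$ are $0$. Let $R=\mathsf k[x,y]$ with its standard grading, where the field $\mathsf k$ has characteristic zero, or is infinite of characteristic $p$ greater than the socle degree $d$ of $T$. For a partition $P=(p_1\ge\cdots\ge p_m)$ let $C_P$ be the set of monomials $x^ay^b$ with $0\le b<m$, $0\le a<p_{b+1}$, and $E_P$ the set of monomials not in $C_P$, and also the monomial ideal they generate. The diagonal lengths of $P$ is the Hilbert function of $R/E_P$. The initial monomial of a form is its monomial of highest $y$-degree with nonzero coefficient; $\mathrm{in}(I)$ is generated by the initial monomials of elements of $I$; the Jordan cell $\mathbb V(E_P)$ is the affine variety (an affine space) parametrizing all graded ideals $I\subset R$ with $\mathrm{in}(I)=E_P$. $\kappa(P)$ is the minimum number of generators of a generic ideal $I\in\mathbb V(E_P)$ (generic: in a suitable nonempty Zariski-open dense subset). $\mathrm G_T$ is the irreducible projective variety parametrizing graded ideals $I\subset R$ such that $R/I$ has Hilbert function $T$,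 and $\kappa(T)$ is the minimum number of generators of a generic $I\in\mathrm G_T$. A partition $P$ of diagonal lengths $T$ is special if $\kappa(P)\ne\kappa(T)$, and non-special otherwise. *)

theory Defs
  imports
    "HOL-Analysis.Abstract_Topology"
    "HOL-Library.Poly_Mapping"
    "HOL-Library.Product_Plus"
begin

section \<open>The graded ring \<open>k[x, y]\<close>\<close>

text \<open>A monomial \<open>x\<^sup>a y\<^sup>b\<close> is encoded by its exponent vector \<open>(a, b)\<close>.\<close>

type_synonym 'k kxy = "(nat \<times> nat) \<Rightarrow>\<^sub>0 'k"

definition monomial_xy :: "nat \<times> nat \<Rightarrow> 'k::field kxy" where
  "monomial_xy m = Poly_Mapping.single m 1"

definition scalar :: "'k::field \<Rightarrow> 'k kxy \<Rightarrow> 'k kxy" where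
  "scalar c f = Poly_Mapping.single 0 c * f"

text \<open>
  The qualifier \<open>kxy\<close> refers to the structure of vector space over the ground field, and
  \<open>ideal\<close> to the structure of module over itself: \<open>ideal.subspace\<close> means
  ``is an ideal'' and \<open>ideal.span G\<close> is the ideal generated by \<open>G\<close>.
\<close>

global_interpretation kxy: vector_space "scalar :: 'k::field \<Rightarrow> 'k kxy \<Rightarrow> 'k kxy"
  by standard
    (simp_all add: scalar_def single_add mult_single distrib_left distrib_right
      mult.assoc[symmetric])

global_interpretation ideal: module "(*) :: 'k::field kxy \<Rightarrow> 'k kxy \<Rightarrow> 'k kxy"
  by standard (simp_all add: algebra_simps)

text \<open>The homogeneous component of degree \<open>i\<close> of the ring (it contains \<open>0\<close>).\<close>

definition forms :: "nat \<Rightarrow> 'k::field kxy set" where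
  "forms i = {f. \<forall>(a, b)\<in>Poly_Mapping.keys f. a + b = i}"

definition graded_ideal :: "'k::field kxy set \<Rightarrow> bool" where
  "graded_ideal I \<longleftrightarrow> (\<exists>H \<subseteq> (\<Union>i. forms i). I = ideal.span H)"

text \<open>
  Hilbert function of the quotient by \<open>I\<close>: the dimension of \<open>R\<^sub>i / I\<^sub>i\<close>. As \<open>R\<^sub>i\<close> is
  finite-dimensional, this is \<open>dim R\<^sub>i - dim I\<^sub>i\<close>, and the subtraction does not truncate.
\<close>

definition hilbert_quot :: "'k::field kxy set \<Rightarrow> nat \<Rightarrow> nat" where
  "hilbert_quot I i = kxy.dim (forms i :: 'k kxy set) - kxy.dim (I \<inter> forms i)"

definition min_gens :: "'k::field kxy set \<Rightarrow> nat" where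
  "min_gens I = (LEAST n. \<exists>G. finite G \<and> card G = n \<and> ideal.span G = I)"

text \<open>
  Only used for nonzero forms, for which the monomial of highest \<open>y\<close>-degree is unique.
\<close>

definition initial_monomial :: "'k::field kxy \<Rightarrow> nat \<times> nat" where
  "initial_monomial f = arg_max_on snd (Poly_Mapping.keys f)"

definition initial_ideal :: "'k::field kxy set \<Rightarrow> 'k kxy set" where
  "initial_ideal I =
     ideal.span {monomial_xy (initial_monomial f) | f i. f \<in> I \<inter> forms i \<and> f \<noteq> 0}"

section \<open>Partitions\<close>

text \<open>Partitions are weakly decreasing lists of positive integers; \<open>P ! b\<close> is \<open>p\<^sub>b\<^sub>+\<^sub>1\<close>.\<close>

definition is_partition :: "nat list \<Rightarrow> bool" where
  "is_partition P \<longleftrightarrow> sorted_wrt (\<ge>) P \<and> (\<forall>p\<in>set P. p > 0)"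

definition C_mon :: "nat list \<Rightarrow> (nat \<times> nat) set" where
  "C_mon P = {(a, b). b < length P \<and> a < P ! b}"

definition E_ideal :: "nat list \<Rightarrow> 'k::field kxy set" where
  "E_ideal P = ideal.span (monomial_xy ` (- C_mon P))"

definition diagonal_lengths :: "'k::field itself \<Rightarrow> nat list \<Rightarrow> nat \<Rightarrow> nat" where
  "diagonal_lengths _ P = hilbert_quot (E_ideal P :: 'k kxy set)"

section \<open>Parameter spaces and their Zariski topology\<close>

definition G_var :: "(nat \<Rightarrow> nat) \<Rightarrow> 'k::field kxy set set" where
  "G_var T = {I. graded_ideal I \<and> hilbert_quot I = T}"

definition jordan_cell :: "nat list \<Rightarrow> 'k::field kxy set set" where
  "jordan_cell P = {I. graded_ideal I \<and> initial_ideal I = E_ideal P}"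

inductive poly_fun :: "(('v \<Rightarrow> 'k::field) \<Rightarrow> 'k) \<Rightarrow> bool" where
  const: "poly_fun (\<lambda>_. c)"
| var: "poly_fun (\<lambda>z. z v)"
| add: "poly_fun F \<Longrightarrow> poly_fun G \<Longrightarrow> poly_fun (\<lambda>z. F z + G z)"
| mult: "poly_fun F \<Longrightarrow> poly_fun G \<Longrightarrow> poly_fun (\<lambda>z. F z * G z)"

text \<open>
  The ideals with Hilbert function \<open>T\<close> form a subvariety of the product over \<open>i\<close> of the
  Grassmannians of subspaces of \<open>R\<^sub>i\<close>, by \<open>I \<mapsto> (I\<^sub>i)\<^sub>i\<close>. Each Grassmannian is the
  quotient of the variety of frames (ordered bases) by the general linear group, and its
  Zariski topology is the quotient topology: a set of subspaces is closed iff the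
  set of all frames of its members is cut out, among all frames, by polynomials in the
  coefficients of the frame vectors (just as closed subsets of projective space
  are read off from their cones). A frame of \<open>I\<close> consists of a basis \<open>v i 0, v i 1, \<dots>\<close>
  of \<open>I\<^sub>i\<close> for every \<open>i\<close>, padded by zeros.
  A Jordan cell is a locally closed subvariety and carries the induced topology; the
  definition below gives the induced topology on any set of ideals with fixed Hilbert function.
\<close>

definition ideal_frame :: "'k::field kxy set \<Rightarrow> (nat \<Rightarrow> nat \<Rightarrow> 'k kxy) \<Rightarrow> bool" where
  "ideal_frame I v \<longleftrightarrow>
     (\<forall>i. let n = kxy.dim (I \<inter> forms i) in
        inj_on (v i) {..<n} \<and> kxy.independent (v i ` {..<n}) \<and>
        kxy.span (v i ` {..<n}) = I \<inter> forms i \<and> (\<forall>j\<ge>n. v i j = 0))"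

definition frame_coords ::
    "(nat \<Rightarrow> nat \<Rightarrow> 'k::field kxy) \<Rightarrow> nat \<times> nat \<times> (nat \<times> nat) \<Rightarrow> 'k" where
  "frame_coords v = (\<lambda>(i, j, m). Poly_Mapping.lookup (v i j) m)"

definition zariski_closed :: "'k::field kxy set set \<Rightarrow> 'k kxy set set \<Rightarrow> bool" where
  "zariski_closed X Z \<longleftrightarrow> Z \<subseteq> X \<and>
     (\<exists>S. (\<forall>F\<in>S. poly_fun F) \<and>
        (\<forall>I\<in>X. \<forall>v. ideal_frame I v \<longrightarrow> (I \<in> Z \<longleftrightarrow> (\<forall>F\<in>S. F (frame_coords v) = 0))))"

definition zariski :: "'k::field kxy set set \<Rightarrow> 'k kxy set topology" where
  "zariski X = topology (\<lambda>U. U \<subseteq> X \<and> zariski_closed X (X - U))"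

lemma zariski_closed_diff_iff:
  "zariski_closed X (X - U) \<longleftrightarrow>
     (\<exists>S. (\<forall>F\<in>S. poly_fun F) \<and>
        (\<forall>I\<in>X. \<forall>v. ideal_frame I v \<longrightarrow> (I \<notin> U \<longleftrightarrow> (\<forall>F\<in>S. F (frame_coords v) = 0))))"
  unfolding zariski_closed_def by auto

lemma istopology_zariski: "istopology (\<lambda>U. U \<subseteq> X \<and> zariski_closed X (X - U))"
  unfolding istopology_def
proof (intro conjI allI impI)
  fix U V assume U: "U \<subseteq> X \<and> zariski_closed X (X - U)" and V: "V \<subseteq> X \<and> zariski_closed X (X - V)"
  show "U \<inter> V \<subseteq> X" using U by auto
  from U obtain S where S: "\<forall>F\<in>S. poly_fun F"
    "\<forall>I\<in>X. \<forall>v. ideal_frame I v \<longrightarrow> (I \<notin> U \<longleftrightarrow> (\<forall>F\<in>S. F (frame_coords v) = 0))"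
    unfolding zariski_closed_diff_iff by (elim conjE exE)
  from V obtain S' where S': "\<forall>F\<in>S'. poly_fun F"
    "\<forall>I\<in>X. \<forall>v. ideal_frame I v \<longrightarrow> (I \<notin> V \<longleftrightarrow> (\<forall>F\<in>S'. F (frame_coords v) = 0))"
    unfolding zariski_closed_diff_iff by (elim conjE exE)
  let ?S = "(\<lambda>(F, G) z. F z * G z) ` (S \<times> S')"
  show "zariski_closed X (X - U \<inter> V)"
    unfolding zariski_closed_diff_iff
  proof (intro exI[of _ ?S] conjI ballI allI impI)
    show "poly_fun H" if "H \<in> ?S" for H
      using that S(1) S'(1) by (auto intro: poly_fun.mult)
    fix I v assume I: "I \<in> X" "ideal_frame I v"
    have "(\<forall>F\<in>?S. F (frame_coords v) = 0) \<longleftrightarrow>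
        (\<forall>F\<in>S. F (frame_coords v) = 0) \<or> (\<forall>F\<in>S'. F (frame_coords v) = 0)"
      by auto
    also have "\<dots> \<longleftrightarrow> I \<notin> U \<or> I \<notin> V"
      using S(2)[rule_format, OF I] S'(2)[rule_format, OF I] by simp
    finally show "I \<notin> U \<inter> V \<longleftrightarrow> (\<forall>F\<in>?S. F (frame_coords v) = 0)" by simp
  qed
next
  fix \<U> assume \<U>: "\<forall>U\<in>\<U>. U \<subseteq> X \<and> zariski_closed X (X - U)"
  then show "\<Union>\<U> \<subseteq> X" by auto
  from \<U> have "\<forall>U\<in>\<U>. \<exists>S. (\<forall>F\<in>S. poly_fun F) \<and>
      (\<forall>I\<in>X. \<forall>v. ideal_frame I v \<longrightarrow> (I \<notin> U \<longleftrightarrow> (\<forall>F\<in>S. F (frame_coords v) = 0)))"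
    unfolding zariski_closed_diff_iff by simp
  from bchoice[OF this] obtain S where S: "\<forall>U\<in>\<U>. (\<forall>F\<in>S U. poly_fun F) \<and>
      (\<forall>I\<in>X. \<forall>v. ideal_frame I v \<longrightarrow> (I \<notin> U \<longleftrightarrow> (\<forall>F\<in>S U. F (frame_coords v) = 0)))"
    by (elim exE)
  show "zariski_closed X (X - \<Union>\<U>)"
    unfolding zariski_closed_diff_iff
  proof (intro exI[of _ "\<Union>U\<in>\<U>. S U"] conjI ballI allI impI)
    show "poly_fun H" if "H \<in> (\<Union>U\<in>\<U>. S U)" for H
      using that S by auto
    fix I v assume "I \<in> X" "ideal_frame I v"
    then have "\<forall>U\<in>\<U>. I \<notin> U \<longleftrightarrow> (\<forall>F\<in>S U. F (frame_coords v) = 0)"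
      using S by simp
    then show "I \<notin> \<Union>\<U> \<longleftrightarrow> (\<forall>F\<in>\<Union>U\<in>\<U>. S U. F (frame_coords v) = 0)" by simp
  qed
qed

lemma openin_zariski: "openin (zariski X) U \<longleftrightarrow> U \<subseteq> X \<and> zariski_closed X (X - U)"
  unfolding zariski_def by (simp add: istopology_zariski)

lemma topspace_zariski [simp]: "topspace (zariski X) = X"
proof -
  have "zariski_closed X (X - X)"
    unfolding zariski_closed_def
    by (auto intro!: exI[of _ "{\<lambda>_. 1}"] poly_fun.const)
  then have "openin (zariski X) X" by (simp add: openin_zariski)
  then show ?thesis
    using openin_subset[of "zariski X" X] openin_topspace[of "zariski X"]
    unfolding openin_zariski by (intro subset_antisym) simp_all
qed

text \<open>
  The value that a numerical invariant \<open>\<phi>\<close> takes on a nonempty dense open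
  subset of \<open>X\<close>.
\<close>

definition generic_on :: "'k::field kxy set set \<Rightarrow> ('k kxy set \<Rightarrow> nat) \<Rightarrow> nat \<Rightarrow> bool" where
  "generic_on X \<phi> n \<longleftrightarrow>
     (\<exists>U. openin (zariski X) U \<and> U \<noteq> {} \<and> zariski X closure_of U = X \<and> (\<forall>I\<in>U. \<phi> I = n))"

definition generic_value :: "'k::field kxy set set \<Rightarrow> ('k kxy set \<Rightarrow> nat) \<Rightarrow> nat" where
  "generic_value X \<phi> = (THE n. generic_on X \<phi> n)"

lemma generic_on_unique:
  assumes "generic_on X \<phi> m" "generic_on X \<phi> n"
  shows "m = n"
proof -
  obtain U where U: "openin (zariski X) U" "zariski X closure_of U = X" "\<forall>I\<in>U. \<phi> I = m"
    using assms(1) unfolding generic_on_def by blast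
  obtain V where V: "openin (zariski X) V" "V \<noteq> {}" "\<forall>I\<in>V. \<phi> I = n"
    using assms(2) unfolding generic_on_def by blast
  have "V \<inter> U \<noteq> {}"
    using U(1,2) V(1,2) openin_subset[OF V(1)] openin_Int_closure_of_eq_empty[OF V(1), of U]
    by (simp add: Int_absorb2)
  then obtain I where "I \<in> U" "I \<in> V" by auto
  then show ?thesis using bspec[OF U(3), of I] bspec[OF V(3), of I] by simp
qed

lemma generic_value_eq: "generic_on X \<phi> n \<Longrightarrow> generic_value X \<phi> = n"
  unfolding generic_value_def using generic_on_unique by (intro the_equality)

definition kappa_partition :: "'k::field itself \<Rightarrow> nat list \<Rightarrow> nat" where
  "kappa_partition _ P = generic_value (jordan_cell P :: 'k kxy set set) min_gens"

definition kappa_hilbert :: "'k::field itself \<Rightarrow> (nat \<Rightarrow> nat) \<Rightarrow> nat" where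
  "kappa_hilbert _ T = generic_value (G_var T :: 'k kxy set set) min_gens"

definition partitions_of_diag :: "'k::field itself \<Rightarrow> (nat \<Rightarrow> nat) \<Rightarrow> nat list set" where
  "partitions_of_diag K T = {P. is_partition P \<and> diagonal_lengths K P = T}"

definition special :: "'k::field itself \<Rightarrow> (nat \<Rightarrow> nat) \<Rightarrow> nat list \<Rightarrow> bool" where
  "special K T P \<longleftrightarrow> kappa_partition K P \<noteq> kappa_hilbert K T"

section \<open>Binomial coefficients, zero outside \<open>0 \<le> b \<le> a\<close>\<close>

definition binom :: "int \<Rightarrow> int \<Rightarrow> nat" where
  "binom a b = (if 0 \<le> b \<and> b \<le> a then nat a choose nat b else 0)"

end

theory Submission
  imports Defs "Jordan_Normal_Form.Determinant"
begin

text \<open>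
  A graded ideal with Hilbert function \<open>T = (1, 2, \<dots>, d, t, 0)\<close> vanishes below degree \<open>d\<close> and is
  everything above it, so it is the same thing as its space \<open>V\<close> of forms of degree \<open>d\<close>, of
  dimension \<open>s = d + 1 - t\<close>. Apart from a basis of \<open>V\<close>, it needs as generators a complement of
  \<open>X V + Y V\<close> in the forms of degree \<open>d + 1\<close>; hence its number of generators is
  \<open>s + (d + 2 - dim (X V + Y V))\<close> (\<open>min_gens_ideal_of_forms\<close>), and generic ideals are those
  for which \<open>X V + Y V\<close> is as large as possible.

  A partition \<open>P\<close> of diagonal lengths \<open>T\<close> is determined by the set \<open>S\<close> of the \<open>y\<close>-exponents of the
  monomials of degree \<open>d\<close> outside of \<open>C\<^sub>P\<close>, which can be any \<open>s\<close>-element subset of \<open>{0, \<dots>, d}\<close>, and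
  the Jordan cell of \<open>P\<close> consists of the \<open>V\<close> whose initial monomials have the \<open>y\<close>-exponents \<open>S\<close>.
  Filter \<open>V\<close> by \<open>y\<close>-degree and follow the codimension of the multiples. It starts with \<open>1\<close>; at an
  exponent outside of \<open>S\<close> the ambient space grows by one dimension and the codimension with it;
  at an exponent in \<open>S\<close> the ambient space also grows by one, but there are two new multiples, so
  that the codimension drops by at most one and cannot become negative. For a suitable \<open>V\<close> it always
  drops when it can, because a lower term can be added to the new form. Therefore
  \<open>\<kappa>(P) = s + gap S (d + 1)\<close>, where \<open>gap S\<close> is the walk with steps \<open>+1\<close> and \<open>-1\<close> that is
  held back at \<open>0\<close>
  (\<open>dim_linear_multiples_le\<close>, \<open>exists_dim_linear_multiples_eq\<close>, \<open>kappa_partition_eq\<close>).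
  The smallest final value of such a walk is \<open>max (t + 1 - s) 0 = \<delta>\<close>, and \<open>\<kappa>(T) = s + \<delta>\<close>.
  The walks with final value at least \<open>h > \<delta>\<close> are counted by Pascal's rule on their last
  step (\<open>card_gap_ge\<close>), and the number is \<open>s + t\<close> choose \<open>s + h\<close>.

  That the maximal dimension is the generic one needs two facts about the Zariski topology. The
  dimension of \<open>X V + Y V\<close> is at least \<open>r\<close> where some determinant in the coefficients of
  a frame does not vanish, an open condition (\<open>open_max_linear_multiples\<close>). And any two nonempty
  open sets meet (\<open>open_sets_meet\<close>), because two ideals of the same cell, or of the whole variety,
  have frames that can be joined by a line, and a nonzero polynomial in one
  variable over an infinite field has a value different from zero.
\<close>

section \<open>Subspaces of finite-dimensional subspaces\<close>

text \<open>
  The polynomial ring has infinite dimension, so the usual monotonicity of the dimension has to be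
  restricted to subspaces of the span of a finite set \<open>W\<close>.
\<close>

lemma (in vector_space) finite_basis_obtain:
  assumes "finite W" "V \<subseteq> span W"
  obtains B where "B \<subseteq> V" "independent B" "V \<subseteq> span B" "card B = dim V" "finite B"
proof -
  obtain B where B: "B \<subseteq> V" "independent B" "V \<subseteq> span B" "card B = dim V"
    by (rule basis_exists[of V])
  moreover have "finite B"
    using independent_span_bound[OF assms(1) B(2)] B(1) assms(2) by blast
  ultimately show ?thesis using that by blast
qed

lemma (in vector_space) independent_card_le_dim_of_finite:
  assumes "finite W" "V \<subseteq> span W" "B \<subseteq> V" "independent B"
  shows "finite B \<and> card B \<le> dim V"
proof -
  obtain C where C: "V \<subseteq> span C" "card C = dim V" "finite C"
    using finite_basis_obtain[OF assms(1,2)] by metis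
  show ?thesis using independent_span_bound[OF C(3) assms(4)] C assms(3) by auto
qed

lemma (in vector_space) dim_subset_of_finite:
  assumes "finite W" "V \<subseteq> span W" "U \<subseteq> V"
  shows "dim U \<le> dim V"
proof -
  obtain B where B: "B \<subseteq> U" "independent B" "card B = dim U"
    by (rule basis_exists[of U])
  have "B \<subseteq> V" using B(1) assms(3) by (rule subset_trans)
  then show ?thesis
    using independent_card_le_dim_of_finite[OF assms(1,2) _ B(2)] B(3) by simp
qed

lemma (in vector_space) subspace_eq_of_dim_ge:
  assumes "finite W" "V \<subseteq> span W" "U \<subseteq> V" "subspace U" "dim V \<le> dim U"
  shows "U = V"
proof -
  have "U \<subseteq> span W" using assms by blast
  then obtain B where B: "B \<subseteq> U" "independent B" "U \<subseteq> span B" "card B = dim U"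
    using finite_basis_obtain[OF assms(1)] by metis
  have "V \<subseteq> span B"
  proof (rule ccontr)
    assume "\<not> V \<subseteq> span B"
    then obtain v where v: "v \<in> V" "v \<notin> span B" by auto
    have i: "independent (insert v B)" using v B by (simp add: independent_insertI)
    have "v \<notin> B" using v span_base by blast
    moreover have "insert v B \<subseteq> V" using v B(1) assms(3) by blast
    then have "finite (insert v B) \<and> card (insert v B) \<le> dim V"
      using independent_card_le_dim_of_finite[OF assms(1,2) _ i] by simp
    ultimately show False using B assms(5) by auto
  qed
  moreover have "span B \<subseteq> U" using B(1) assms(4) span_minimal by blast
  ultimately show ?thesis using assms(3) by blast
qed

lemma (in vector_space) dim_insert_of_finite:
  assumes "finite W" "V \<subseteq> span W" "f \<notin> span V"
  shows "dim (insert f V) = Suc (dim V)"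
proof -
  obtain B where B: "B \<subseteq> V" "independent B" "V \<subseteq> span B" "card B = dim V" "finite B"
    using finite_basis_obtain[OF assms(1,2)] .
  have sp: "span B = span V"
    using B by (metis span_mono span_span subset_antisym span_minimal subspace_span)
  have "f \<notin> B" using assms(3) sp span_base by metis
  have "dim (insert f V) = card (insert f B)"
  proof (rule dim_unique)
    show "insert f B \<subseteq> insert f V" using B by auto
    show "insert f V \<subseteq> span (insert f B)"
      using B span_mono[of B "insert f B"] span_base[of f "insert f B"] by auto
    show "independent (insert f B)" using B assms(3) sp by (simp add: independent_insertI)
  qed simp
  then show ?thesis using B \<open>f \<notin> B\<close> by simp
qed

lemma (in vector_space) dim_insert_le_of_finite:
  assumes "finite W" "V \<subseteq> span W"
  shows "dim (insert f V) \<le> Suc (dim V)"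
proof (cases "f \<in> span V")
  case True
  then have "span (insert f V) = span V" by (simp add: span_redundant)
  then show ?thesis by (metis dim_span le_SucI order_refl)
next
  case False
  then show ?thesis using dim_insert_of_finite[OF assms] by simp
qed

section \<open>Forms of bounded \<open>y\<close>-degree\<close>

lemma lookup_scalar [simp]: "Poly_Mapping.lookup (scalar c f) m = c * Poly_Mapping.lookup f m"
  by (simp add: scalar_def mult_map_scale_conv_mult[symmetric] Poly_Mapping.map.rep_eq when_def)

lemma lookup_monomial_mult:
  "Poly_Mapping.lookup (monomial_xy (p, q) * f) (a, b)
     = (if p \<le> a \<and> q \<le> b then Poly_Mapping.lookup f (a - p, b - q) else 0)"
proof -
  have eq: "(a, b) = (p, q) + r \<longleftrightarrow> (p \<le> a \<and> q \<le> b) \<and> r = (a - p, b - q)" for r :: "nat \<times> nat"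
    by (cases r) auto
  have "Poly_Mapping.lookup (monomial_xy (p, q) * f) (a, b)
      = Sum_any (\<lambda>r. Poly_Mapping.lookup f r when (a, b) = (p, q) + r)"
    by (simp add: lookup_mult monomial_xy_def lookup_single when_mult)
  also have "\<dots> = Sum_any (\<lambda>r. (Poly_Mapping.lookup f r when (p \<le> a \<and> q \<le> b)) when r = (a - p, b - q))"
    by (simp only: eq when_when conj_commute)
  also have "\<dots> = (Poly_Mapping.lookup f (a - p, b - q) when (p \<le> a \<and> q \<le> b))"
    by (rule Sum_any_when_equal)
  finally show ?thesis by (simp add: when_def)
qed

lemma scalar_mult: "g * scalar c f = scalar c (g * f)" for f g :: "'k::field kxy"
  by (simp add: scalar_def mult.left_commute)

text \<open>
  The filtration of the forms of degree \<open>n\<close> by \<open>y\<close>-degree. The bound is strict, so that the steps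
  \<open>m = 0, \<dots>, n + 1\<close> have dimension \<open>m\<close>.
\<close>

definition low_forms :: "nat \<Rightarrow> nat \<Rightarrow> 'k::field kxy set" where
  "low_forms n m = {f. \<forall>a b. Poly_Mapping.lookup f (a, b) \<noteq> 0 \<longrightarrow> a + b = n \<and> b < m}"

definition form_monomial :: "nat \<Rightarrow> nat \<Rightarrow> 'k::field kxy" where
  "form_monomial n b = monomial_xy (n - b, b)"

abbreviation coeff_y :: "nat \<Rightarrow> 'k::field kxy \<Rightarrow> nat \<Rightarrow> 'k" where
  "coeff_y n f b \<equiv> Poly_Mapping.lookup f (n - b, b)"

lemma lookup_form_monomial:
  "Poly_Mapping.lookup (form_monomial n b) m = (if m = (n - b, b) then 1 else 0)"
  by (simp add: form_monomial_def monomial_xy_def lookup_single when_def)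

lemma forms_iff:
  "f \<in> forms n \<longleftrightarrow> (\<forall>a b. Poly_Mapping.lookup f (a, b) \<noteq> 0 \<longrightarrow> a + b = n)"
  by (auto simp: forms_def in_keys_iff)

lemma forms_eq_low_forms: "forms n = low_forms n (Suc n)"
proof (intro Set.set_eqI)
  have "a + b = n \<longleftrightarrow> a + b = n \<and> b < Suc n" for a b by auto
  then show "f \<in> forms n \<longleftrightarrow> f \<in> low_forms n (Suc n)" for f :: "'a kxy"
    unfolding low_forms_def forms_iff by auto
qed

lemma subspace_low_forms: "kxy.subspace (low_forms n m)"
proof (rule kxy.subspaceI)
  fix f g :: "'a kxy" assume "f \<in> low_forms n m" "g \<in> low_forms n m"
  moreover have "Poly_Mapping.lookup (f + g) x \<noteq> 0 \<Longrightarrow>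
      Poly_Mapping.lookup f x \<noteq> 0 \<or> Poly_Mapping.lookup g x \<noteq> 0" for x
    by (auto simp: lookup_add)
  ultimately show "f + g \<in> low_forms n m" unfolding low_forms_def by blast
qed (auto simp: low_forms_def)

lemma subspace_forms: "kxy.subspace (forms n)"
  unfolding forms_eq_low_forms by (rule subspace_low_forms)

lemma low_forms_mono: "m \<le> m' \<Longrightarrow> low_forms n m \<subseteq> low_forms n m'"
  unfolding low_forms_def by force

lemma low_forms_subset_Suc: "low_forms n m \<subseteq> low_forms n (Suc m)"
  by (rule low_forms_mono) simp

lemma low_forms_subset_forms: "low_forms n m \<subseteq> forms n"
  unfolding low_forms_def by (auto simp: forms_iff)

lemma form_monomial_mem: "b < m \<Longrightarrow> b \<le> n \<Longrightarrow> form_monomial n b \<in> low_forms n m"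
  by (auto simp: low_forms_def lookup_form_monomial split: if_splits)

lemma low_forms_expansion:
  assumes "f \<in> low_forms n m"
  shows "f = (\<Sum>b<m. scalar (coeff_y n f b) (form_monomial n b))"
proof (rule poly_mapping_eqI)
  fix k :: "nat \<times> nat"
  obtain a c where k: "k = (a, c)" by (cases k)
  have "Poly_Mapping.lookup (\<Sum>b<m. scalar (coeff_y n f b) (form_monomial n b)) k
      = (\<Sum>b<m. coeff_y n f b * (if k = (n - b, b) then 1 else 0))"
    by (simp add: lookup_sum lookup_form_monomial)
  also have "\<dots> = (\<Sum>b<m. if b = c then (if a = n - c then coeff_y n f c else 0) else 0)"
    by (intro sum.cong) (auto simp: k)
  also have "\<dots> = (if c < m \<and> a = n - c then coeff_y n f c else 0)" by simp
  also have "\<dots> = Poly_Mapping.lookup f k"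
    using assms unfolding low_forms_def k by fastforce
  finally show "Poly_Mapping.lookup f k
      = Poly_Mapping.lookup (\<Sum>b<m. scalar (coeff_y n f b) (form_monomial n b)) k" by simp
qed

lemma low_forms_subset_span: "low_forms n m \<subseteq> kxy.span (form_monomial n ` {..<m})"
proof
  fix f :: "'a kxy" assume "f \<in> low_forms n m"
  then have "f = (\<Sum>b<m. scalar (coeff_y n f b) (form_monomial n b))"
    by (rule low_forms_expansion)
  also have "\<dots> \<in> kxy.span (form_monomial n ` {..<m})"
    by (intro kxy.span_sum kxy.span_scale kxy.span_base) auto
  finally show "f \<in> kxy.span (form_monomial n ` {..<m})" .
qed

lemma low_forms_step:
  assumes "f \<in> low_forms n (Suc m)"
  shows "f \<in> low_forms n m \<longleftrightarrow> coeff_y n f m = 0"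
proof
  assume "coeff_y n f m = 0"
  show "f \<in> low_forms n m"
    unfolding low_forms_def
  proof (intro CollectI allI impI)
    fix a b assume nz: "Poly_Mapping.lookup f (a, b) \<noteq> 0"
    then have ab: "a + b = n" "b < Suc m" using assms by (auto simp: low_forms_def)
    moreover have "b \<noteq> m"
    proof
      assume "b = m"
      then have "a = n - m" using ab by simp
      then show False using nz \<open>b = m\<close> \<open>coeff_y n f m = 0\<close> by simp
    qed
    ultimately show "a + b = n \<and> b < m" by simp
  qed
qed (auto simp: low_forms_def)

text \<open>
  These are the premises under which the facts of finite-dimensional linear algebra above apply
  to spaces of forms.
\<close>

lemmas forms_finite =
  finite_imageI[OF finite_lessThan[of "Suc n"], of "form_monomial n"]
  low_forms_subset_span[of n "Suc n", folded forms_eq_low_forms] for n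

section \<open>Leading exponents\<close>

text \<open>
  The \<open>y\<close>-exponents of the initial monomials of the forms of degree \<open>n\<close> in \<open>V\<close>.
\<close>

definition leads :: "nat \<Rightarrow> 'k::field kxy set \<Rightarrow> nat set" where
  "leads n V = {b. b \<le> n \<and> (\<exists>f\<in>V. f \<in> low_forms n (Suc b) \<and> coeff_y n f b \<noteq> 0)}"

lemma leads_subset: "leads n V \<subseteq> {..n}"
  by (auto simp: leads_def)

lemma leads_mono: "U \<subseteq> V \<Longrightarrow> leads n U \<subseteq> leads n V"
  unfolding leads_def by blast

lemma span_eq_insert:
  assumes V: "kxy.subspace V" and f: "f \<in> V \<inter> low_forms n (Suc m)" "coeff_y n f m \<noteq> 0"
  shows "V \<inter> low_forms n (Suc m) = kxy.span (insert f (V \<inter> low_forms n m))"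
proof
  have sub: "kxy.subspace (V \<inter> low_forms n (Suc m))"
    by (intro kxy.subspace_inter V subspace_low_forms)
  show "kxy.span (insert f (V \<inter> low_forms n m)) \<subseteq> V \<inter> low_forms n (Suc m)"
  proof (rule kxy.span_minimal[OF _ sub])
    show "insert f (V \<inter> low_forms n m) \<subseteq> V \<inter> low_forms n (Suc m)"
      using f low_forms_subset_Suc[of n m] by blast
  qed
  show "V \<inter> low_forms n (Suc m) \<subseteq> kxy.span (insert f (V \<inter> low_forms n m))"
  proof
    fix g assume g: "g \<in> V \<inter> low_forms n (Suc m)"
    define c where "c = coeff_y n g m / coeff_y n f m"
    let ?h = "g - scalar c f"
    have "?h \<in> V \<inter> low_forms n (Suc m)"
      using sub g f by (intro kxy.subspace_diff kxy.subspace_scale)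
    moreover have "coeff_y n ?h m = 0" using f by (simp add: lookup_minus c_def)
    ultimately have "?h \<in> V \<inter> low_forms n m" by (simp add: low_forms_step)
    then have "?h + scalar c f \<in> kxy.span (insert f (V \<inter> low_forms n m))"
      by (intro kxy.span_add kxy.span_scale) (auto intro: kxy.span_base)
    then show "g \<in> kxy.span (insert f (V \<inter> low_forms n m))" by simp
  qed
qed

lemma notin_span_of_coeff:
  assumes "coeff_y n f m \<noteq> 0" "W \<subseteq> low_forms n m"
  shows "f \<notin> kxy.span W"
proof
  assume "f \<in> kxy.span W"
  then have "f \<in> low_forms n m" using assms(2) kxy.span_minimal[OF _ subspace_low_forms] by blast
  then show False using assms(1) by (auto simp: low_forms_def)
qed

text \<open>
  The quotient of two consecutive steps of the filtration by \<open>y\<close>-degree has dimension one at a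
  leading exponent and is zero otherwise.
\<close>

lemma dim_low_part:
  assumes V: "kxy.subspace V" and m: "m \<le> Suc n"
  shows "kxy.dim (V \<inter> low_forms n m) = card (leads n V \<inter> {..<m})"
  using m
proof (induction m)
  case 0
  have "low_forms n 0 = {0 :: 'a kxy}"
    by (auto simp: low_forms_def intro!: poly_mapping_eqI)
  then have "V \<inter> low_forms n 0 = {0}" using kxy.subspace_0[OF V] by auto
  then have "kxy.dim (V \<inter> low_forms n 0) = kxy.dim {0 :: 'a kxy}" by simp
  also have "\<dots> = card ({} :: 'a kxy set)" by (rule kxy.dim_unique[where B = "{}"]) (simp_all add: kxy.independent_empty)
  finally show ?case by simp
next
  case (Suc m)
  let ?V = "V \<inter> low_forms n m"
  show ?case
  proof (cases "m \<in> leads n V")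
    case True
    then obtain f where f: "f \<in> V \<inter> low_forms n (Suc m)" "coeff_y n f m \<noteq> 0"
      by (auto simp: leads_def)
    have "kxy.dim (V \<inter> low_forms n (Suc m)) = kxy.dim (insert f ?V)"
      by (simp add: span_eq_insert[OF V f])
    also have "\<dots> = Suc (kxy.dim ?V)"
      using notin_span_of_coeff[OF f(2), of ?V] low_forms_subset_span[of n m]
      by (intro kxy.dim_insert_of_finite[of "form_monomial n ` {..<m}"]) auto
    finally show ?thesis using Suc True by (simp add: lessThan_Suc)
  next
    case False
    have "V \<inter> low_forms n (Suc m) = ?V"
    proof (intro Set.set_eqI iffI)
      fix f assume f: "f \<in> V \<inter> low_forms n (Suc m)"
      then have "coeff_y n f m = 0" using False Suc.prems by (auto simp: leads_def)
      then show "f \<in> ?V" using f by (simp add: low_forms_step)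
    next
      show "f \<in> V \<inter> low_forms n (Suc m)" if "f \<in> ?V" for f
        using that low_forms_subset_Suc[of n m] by blast
    qed
    then show ?thesis using Suc False by (simp add: lessThan_Suc)
  qed
qed

lemma dim_eq_card_leads:
  assumes "kxy.subspace V" "V \<subseteq> forms n"
  shows "kxy.dim V = card (leads n V)"
proof -
  have "V \<inter> low_forms n (Suc n) = V" using assms(2) by (auto simp: forms_eq_low_forms)
  moreover have "leads n V \<inter> {..<Suc n} = leads n V" using leads_subset[of n V] by auto
  ultimately show ?thesis using dim_low_part[OF assms(1), of "Suc n" n] by simp
qed

lemma leads_low_forms:
  assumes "m \<le> Suc n"
  shows "leads n (low_forms n m :: 'k::field kxy set) = {..<m}"
proof (intro Set.set_eqI iffI)
  fix b assume "b \<in> {..<m}"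
  then show "b \<in> leads n (low_forms n m :: 'k kxy set)"
    unfolding leads_def using assms
    by (auto intro!: bexI[of _ "form_monomial n b"] simp: form_monomial_mem lookup_form_monomial)
qed (auto simp: leads_def low_forms_def)

lemma dim_low_forms: "m \<le> Suc n \<Longrightarrow> kxy.dim (low_forms n m :: 'k::field kxy set) = m"
  using dim_eq_card_leads[OF subspace_low_forms low_forms_subset_forms, of n m]
  by (simp add: leads_low_forms)

lemma dim_forms: "kxy.dim (forms n :: 'k::field kxy set) = Suc n"
  by (simp add: forms_eq_low_forms dim_low_forms)

section \<open>Multiples by linear forms\<close>

abbreviation X :: "'k::field kxy" where "X \<equiv> monomial_xy (1, 0)"
abbreviation Y :: "'k::field kxy" where "Y \<equiv> monomial_xy (0, 1)"

definition linear_multiples :: "'k::field kxy set \<Rightarrow> 'k kxy set" where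
  "linear_multiples V = kxy.span ((*) X ` V \<union> (*) Y ` V)"

lemma X_mult_low_forms: "f \<in> low_forms n m \<Longrightarrow> X * f \<in> low_forms (Suc n) m"
  by (fastforce simp: low_forms_def lookup_monomial_mult split: if_splits)

lemma Y_mult_low_forms: "f \<in> low_forms n m \<Longrightarrow> Y * f \<in> low_forms (Suc n) (Suc m)"
  by (fastforce simp: low_forms_def lookup_monomial_mult split: if_splits)

lemma coeff_y_Y_mult: "coeff_y (Suc n) (Y * f) (Suc b) = coeff_y n f b"
  by (simp add: lookup_monomial_mult)

lemma linear_multiples_subset:
  assumes "V \<subseteq> low_forms n m"
  shows "linear_multiples V \<subseteq> low_forms (Suc n) (Suc m)"
  unfolding linear_multiples_def
proof (rule kxy.span_minimal[OF _ subspace_low_forms])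
  show "(*) X ` V \<union> (*) Y ` V \<subseteq> low_forms (Suc n) (Suc m)"
    using assms X_mult_low_forms[of _ n m] Y_mult_low_forms[of _ n m]
      low_forms_subset_Suc[of "Suc n" m] by blast
qed

lemma linear_multiples_subset_forms:
  "V \<subseteq> forms n \<Longrightarrow> linear_multiples V \<subseteq> forms (Suc n)"
  using linear_multiples_subset[of V n "Suc n"] by (simp add: forms_eq_low_forms)

lemma mult_mem_span_image:
  fixes f g :: "'k::field kxy"
  assumes "f \<in> kxy.span A"
  shows "g * f \<in> kxy.span ((*) g ` A)"
proof -
  have "kxy.span A \<subseteq> {f. g * f \<in> kxy.span ((*) g ` A)}"
  proof (rule kxy.span_minimal)
    show "A \<subseteq> {f. g * f \<in> kxy.span ((*) g ` A)}"
      by (auto intro: kxy.span_base)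
    show "kxy.subspace {f. g * f \<in> kxy.span ((*) g ` A)}"
      unfolding kxy.subspace_def
      by (simp add: kxy.span_zero distrib_left kxy.span_add scalar_mult kxy.span_scale)
  qed
  then show ?thesis using assms by blast
qed

lemma linear_multiples_span: "linear_multiples (kxy.span A) = linear_multiples A"
proof
  show "linear_multiples (kxy.span A) \<subseteq> linear_multiples A"
    unfolding linear_multiples_def
  proof (rule kxy.span_minimal[OF _ kxy.subspace_span])
    have "kxy.span ((*) g ` A) \<subseteq> kxy.span ((*) X ` A \<union> (*) Y ` A)" if "g \<in> {X, Y}" for g
      using that by (intro kxy.span_mono) auto
    then show "(*) X ` kxy.span A \<union> (*) Y ` kxy.span A \<subseteq> kxy.span ((*) X ` A \<union> (*) Y ` A)"
      using mult_mem_span_image[of _ A] by blast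
  qed
  show "linear_multiples A \<subseteq> linear_multiples (kxy.span A)"
    unfolding linear_multiples_def using kxy.span_superset[of A]
    by (intro kxy.span_mono) blast
qed

lemma linear_multiples_insert:
  "linear_multiples (insert f V)
     = kxy.span (insert (Y * f) (insert (X * f) ((*) X ` V \<union> (*) Y ` V)))"
  unfolding linear_multiples_def by (rule arg_cong[where f = kxy.span]) auto

lemma subspace_linear_multiples: "kxy.subspace (linear_multiples V)"
  by (simp add: linear_multiples_def)

lemma dim_linear_multiples_insert_le:
  assumes "V \<subseteq> forms n"
  shows "kxy.dim (linear_multiples (insert f V)) \<le> kxy.dim (linear_multiples V) + 2"
proof -
  let ?G = "(*) X ` V \<union> (*) Y ` V"
  let ?W = "form_monomial (Suc n) ` {..<Suc (Suc n)}"
  have "?G \<subseteq> forms (Suc n)"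
    using linear_multiples_subset_forms[OF assms] kxy.span_superset[of ?G]
    unfolding linear_multiples_def by blast
  then have G: "?G \<subseteq> kxy.span ?W" using forms_finite(2)[of "Suc n"] by blast
  have "kxy.dim (insert (Y * f) (insert (X * f) ?G)) \<le> Suc (kxy.dim (insert (X * f) ?G))"
  proof (rule kxy.dim_insert_le_of_finite[of "insert (X * f) ?W"])
    have "kxy.span ?W \<subseteq> kxy.span (insert (X * f) ?W)" by (rule kxy.span_mono) auto
    then show "insert (X * f) ?G \<subseteq> kxy.span (insert (X * f) ?W)"
      using G by (auto intro: kxy.span_base)
  qed simp
  also have "kxy.dim (insert (X * f) ?G) \<le> Suc (kxy.dim ?G)"
    by (rule kxy.dim_insert_le_of_finite[OF _ G]) simp
  finally show ?thesis
    by (simp add: linear_multiples_insert) (simp add: linear_multiples_def)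
qed

text \<open>
  The least codimension that the multiples of a space with leading exponents \<open>S\<close>, cut off at
  \<open>y\<close>-degree below \<open>m\<close>, can have in the forms of \<open>y\<close>-degree at most \<open>m\<close>. Each step enlarges these
  forms by one dimension, and an exponent in \<open>S\<close> contributes two multiples, \<open>X * f\<close> and \<open>Y * f\<close>.
  The subtraction is truncated because a codimension cannot be negative. At \<open>m = 0\<close> there are no
  multiples, while the forms of \<open>y\<close>-degree \<open>0\<close> have dimension one.
\<close>

fun gap :: "nat set \<Rightarrow> nat \<Rightarrow> nat" where
  "gap S 0 = 1"
| "gap S (Suc m) = (if m \<in> S then gap S m - 1 else Suc (gap S m))"

lemma dim_linear_multiples_le:
  assumes V: "kxy.subspace V" and m: "m \<le> Suc n"
  shows "kxy.dim (linear_multiples (V \<inter> low_forms n m)) + gap (leads n V) m \<le> Suc m"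
  using m
proof (induction m)
  case 0
  have "linear_multiples (V \<inter> low_forms n 0) \<subseteq> low_forms (Suc n) 0"
  proof -
    have "low_forms k 0 = {0 :: 'a kxy}" for k
      by (auto simp: low_forms_def intro!: poly_mapping_eqI)
    then have "V \<inter> low_forms n 0 = {0}" using kxy.subspace_0[OF V] by simp
    then show ?thesis
      by (simp add: linear_multiples_def low_forms_def)
  qed
  then have "kxy.dim (linear_multiples (V \<inter> low_forms n 0)) \<le> kxy.dim (low_forms (Suc n) 0 :: 'a kxy set)"
    by (rule kxy.dim_subset_of_finite[OF _ low_forms_subset_span, rotated]) simp
  then show ?case by (simp add: dim_low_forms)
next
  case (Suc m)
  let ?V = "V \<inter> low_forms n m" and ?V' = "V \<inter> low_forms n (Suc m)"
  have IH: "kxy.dim (linear_multiples ?V) + gap (leads n V) m \<le> Suc m"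
    using Suc by simp
  show ?case
  proof (cases "m \<in> leads n V")
    case True
    then obtain f where f: "f \<in> ?V'" "coeff_y n f m \<noteq> 0"
      by (auto simp: leads_def)
    have "linear_multiples ?V' = linear_multiples (insert f ?V)"
      unfolding span_eq_insert[OF V f] by (rule linear_multiples_span)
    then have le: "kxy.dim (linear_multiples ?V') \<le> kxy.dim (linear_multiples ?V) + 2"
      using dim_linear_multiples_insert_le[of ?V n f] low_forms_subset_forms[of n m] by auto
    have "linear_multiples ?V' \<subseteq> low_forms (Suc n) (Suc (Suc m))"
      by (rule linear_multiples_subset) simp
    then have "kxy.dim (linear_multiples ?V')
        \<le> kxy.dim (low_forms (Suc n) (Suc (Suc m)) :: 'a kxy set)"
      by (rule kxy.dim_subset_of_finite[OF _ low_forms_subset_span, rotated]) simp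
    then have "kxy.dim (linear_multiples ?V') \<le> Suc (Suc m)"
      using Suc.prems by (simp add: dim_low_forms)
    then show ?thesis using IH le True by auto
  next
    case False
    have "?V' = ?V"
    proof
      show "?V' \<subseteq> ?V"
      proof
        fix f assume f: "f \<in> ?V'"
        then have "coeff_y n f m = 0" using False Suc.prems by (auto simp: leads_def)
        then show "f \<in> ?V" using f by (simp add: low_forms_step)
      qed
      show "?V \<subseteq> ?V'" using low_forms_subset_Suc[of n m] by blast
    qed
    then show ?thesis using IH False by simp
  qed
qed

text \<open>
  The bound by the gap is attained greedily. If the multiples found so far do not fill the forms of
  \<open>y\<close>-degree at most \<open>m\<close>, then the next form can be chosen with \<open>X * f\<close> outside of them, by adding a
  monomial to the leading one if necessary; and \<open>Y * f\<close> is always new for degree reasons.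
\<close>

lemma exists_form_with_new_multiple:
  assumes W: "kxy.subspace W" "W \<subset> low_forms (Suc n) (Suc m)" and m: "m \<le> n"
  shows "\<exists>f. f \<in> low_forms n (Suc m) \<and> coeff_y n f m \<noteq> 0 \<and> X * f \<notin> W"
proof (cases "X * form_monomial n m \<in> W")
  case True
  have Xmon: "X * form_monomial n c = form_monomial (Suc n) c" if "c \<le> n" for c
    using that by (auto intro!: poly_mapping_eqI simp: form_monomial_def monomial_xy_def
        mult_single Suc_diff_le)
  have "\<exists>c. c < m \<and> X * form_monomial n c \<notin> W"
  proof (rule ccontr)
    assume "\<not> ?thesis"
    then have "X * form_monomial n c \<in> W" if "c < Suc m" for c
      using True that by (cases "c = m") simp_all
    then have "form_monomial (Suc n) c \<in> W" if "c < Suc m" for c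
      using Xmon[of c] m that by (metis less_Suc_eq_le order_trans)
    then have "form_monomial (Suc n) ` {..<Suc m} \<subseteq> W" by auto
    then have "low_forms (Suc n) (Suc m) \<subseteq> W"
      using low_forms_subset_span[of "Suc n" "Suc m"] kxy.span_minimal[OF _ W(1)] by blast
    then show False using W(2) by blast
  qed
  then obtain c where c: "c < m" "X * form_monomial n c \<notin> W" by blast
  let ?f = "form_monomial n m + form_monomial n c"
  have "?f \<in> low_forms n (Suc m)"
    using c m by (intro kxy.subspace_add[OF subspace_low_forms] form_monomial_mem) auto
  moreover have "coeff_y n ?f m \<noteq> 0"
    using c by (simp add: lookup_add lookup_form_monomial)
  moreover have "X * ?f \<notin> W"
  proof
    assume "X * ?f \<in> W"
    then have "X * ?f - X * form_monomial n m \<in> W" by (rule kxy.subspace_diff[OF W(1) _ True])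
    then show False using c(2) by (simp add: distrib_left)
  qed
  ultimately show ?thesis by blast
next
  case False
  then show ?thesis
    using m by (intro exI[of _ "form_monomial n m"])
      (simp add: form_monomial_mem lookup_form_monomial)
qed

lemma exists_dim_linear_multiples_eq:
  assumes m: "m \<le> Suc n"
  shows "\<exists>V :: 'k::field kxy set. kxy.subspace V \<and> V \<subseteq> low_forms n m \<and> leads n V = S \<inter> {..<m}
    \<and> kxy.dim (linear_multiples V) + gap S m = Suc m"
  using m
proof (induction m)
  case 0
  have low0: "low_forms k 0 = {0 :: 'k kxy}" for k
    by (auto simp: low_forms_def intro!: poly_mapping_eqI)
  have "linear_multiples {0 :: 'k kxy} = low_forms 0 0"
    by (simp add: linear_multiples_def low0)
  then have "kxy.dim (linear_multiples {0 :: 'k kxy}) = 0"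
    by (simp add: dim_low_forms)
  moreover have "leads n {0 :: 'k kxy} = {}" by (auto simp: leads_def)
  ultimately show ?case
    by (intro exI[of _ "{0}"]) (simp add: low0)
next
  case (Suc m)
  then obtain V :: "'k kxy set" where V: "kxy.subspace V" "V \<subseteq> low_forms n m"
    "leads n V = S \<inter> {..<m}" "kxy.dim (linear_multiples V) + gap S m = Suc m"
    by auto
  have Vforms: "V \<subseteq> forms n" using V(2) low_forms_subset_forms by (rule order_trans)
  show ?case
  proof (cases "m \<in> S")
    case False
    have "V \<subseteq> low_forms n (Suc m)" using V(2) low_forms_subset_Suc by (rule subset_trans)
    moreover have "leads n V = S \<inter> {..<Suc m}" using V(3) False by (simp add: lessThan_Suc)
    moreover have "kxy.dim (linear_multiples V) + gap S (Suc m) = Suc (Suc m)"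
      using V(4) False by simp
    ultimately show ?thesis using V(1) by blast
  next
    case True
    let ?W = "linear_multiples V"
    have W: "?W \<subseteq> low_forms (Suc n) (Suc m)" by (rule linear_multiples_subset[OF V(2)])
    have "\<exists>f. f \<in> low_forms n (Suc m) \<and> coeff_y n f m \<noteq> 0 \<and> (gap S m > 0 \<longrightarrow> X * f \<notin> ?W)"
    proof (cases "gap S m = 0")
      case True
      then show ?thesis
        using Suc.prems by (intro exI[of _ "form_monomial n m"])
          (simp add: form_monomial_mem lookup_form_monomial)
    next
      case False
      then have "kxy.dim ?W \<noteq> kxy.dim (low_forms (Suc n) (Suc m) :: 'k kxy set)"
        using V(4) Suc.prems by (simp add: dim_low_forms)
      then have "?W \<noteq> low_forms (Suc n) (Suc m)" by metis
      then show ?thesis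
        using exists_form_with_new_multiple[OF subspace_linear_multiples, of V n m] W Suc.prems
        by blast
    qed
    then obtain f where f: "f \<in> low_forms n (Suc m)" "coeff_y n f m \<noteq> 0"
      "gap S m > 0 \<longrightarrow> X * f \<notin> ?W" by (elim exE conjE)
    let ?V' = "kxy.span (insert f V)"
    have V'low: "?V' \<subseteq> low_forms n (Suc m)"
      using f(1) order_trans[OF V(2) low_forms_subset_Suc[of n m]]
      by (intro kxy.span_minimal[OF _ subspace_low_forms] insert_subsetI)
    have V'forms: "?V' \<subseteq> forms n" using V'low low_forms_subset_forms by (rule order_trans)
    have leads: "leads n ?V' = insert m (leads n V)"
    proof (rule sym, rule card_seteq)
      show "finite (leads n ?V')" by (rule finite_subset[OF leads_subset]) simp
      have "leads n V \<subseteq> leads n ?V'"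
        by (rule leads_mono) (auto intro: kxy.span_base)
      moreover have "m \<in> leads n ?V'"
        unfolding leads_def using f Suc.prems by (auto intro: kxy.span_base)
      ultimately show "insert m (leads n V) \<subseteq> leads n ?V'" by simp
      have "kxy.dim ?V' \<le> Suc (kxy.dim V)"
        using kxy.dim_insert_le_of_finite[OF forms_finite(1)[of n], of V f]
          Vforms forms_finite(2)[of n] by auto
      then show "card (leads n ?V') \<le> card (insert m (leads n V))"
        using dim_eq_card_leads[OF V(1) Vforms] dim_eq_card_leads[OF _ V'forms] V(3) by simp
    qed
    let ?G = "(*) X ` V \<union> (*) Y ` V"
    have spG: "kxy.span ?G = ?W" by (simp add: linear_multiples_def)
    have XfG: "insert (X * f) ?G \<subseteq> low_forms (Suc n) (Suc m)"
      using W kxy.span_superset[of ?G] X_mult_low_forms[OF f(1)] unfolding spG by blast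
    have new: "Y * f \<notin> kxy.span (insert (X * f) ?G)"
      by (rule notin_span_of_coeff[OF _ XfG]) (unfold coeff_y_Y_mult, rule f(2))
    have dimG: "kxy.dim ?G = kxy.dim ?W" by (simp flip: spG)
    have fin: "finite (form_monomial (Suc n) ` {..<Suc m})" by simp
    have Gsub: "insert (X * f) ?G \<subseteq> kxy.span (form_monomial (Suc n) ` {..<Suc m})"
      using XfG low_forms_subset_span by (rule order_trans)
    have "linear_multiples ?V' = kxy.span (insert (Y * f) (insert (X * f) ?G))"
      by (simp add: linear_multiples_span linear_multiples_insert)
    then have "kxy.dim (linear_multiples ?V') = kxy.dim (insert (Y * f) (insert (X * f) ?G))"
      by simp
    also have "\<dots> = Suc (kxy.dim (insert (X * f) ?G))"
      by (rule kxy.dim_insert_of_finite[OF fin Gsub new])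
    finally have dim': "kxy.dim (linear_multiples ?V') = Suc (kxy.dim (insert (X * f) ?G))" .
    have "kxy.dim (insert (X * f) ?G) + (gap S m - 1) = Suc m"
    proof (cases "gap S m = 0")
      case True
      then have "kxy.dim ?W = kxy.dim (low_forms (Suc n) (Suc m) :: 'k kxy set)"
        using V(4) Suc.prems by (simp add: dim_low_forms)
      then have "?W = low_forms (Suc n) (Suc m)"
        using kxy.subspace_eq_of_dim_ge[OF fin low_forms_subset_span W subspace_linear_multiples]
        by simp
      then have "X * f \<in> kxy.span ?G" using XfG unfolding spG by simp
      then have "kxy.span (insert (X * f) ?G) = kxy.span ?G" by (rule kxy.span_redundant)
      then have "kxy.dim (insert (X * f) ?G) = kxy.dim ?G" by (rule kxy.span_eq_dim)
      then show ?thesis using True V(4) dimG by simp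
    next
      case False
      then have "X * f \<notin> kxy.span ?G" using f(3) unfolding spG by simp
      then have "kxy.dim (insert (X * f) ?G) = Suc (kxy.dim ?G)"
        using Gsub by (intro kxy.dim_insert_of_finite[OF fin]) auto
      then show ?thesis using False V(4) dimG by simp
    qed
    then have "kxy.dim (linear_multiples ?V') + gap S (Suc m) = Suc (Suc m)"
      using dim' True by simp
    moreover have "leads n ?V' = S \<inter> {..<Suc m}"
      using leads V(3) True by (simp add: lessThan_Suc)
    ultimately show ?thesis using V'low kxy.subspace_span by blast
  qed
qed

section \<open>Homogeneous components and ideals\<close>

definition form_part :: "nat \<Rightarrow> 'k::field kxy \<Rightarrow> 'k kxy" where
  "form_part n f = (\<Sum>b<Suc n. scalar (coeff_y n f b) (form_monomial n b))"

lemma lookup_form_part: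
  "Poly_Mapping.lookup (form_part n f) (a, b)
     = (if a + b = n then Poly_Mapping.lookup f (a, b) else 0)"
proof -
  have "Poly_Mapping.lookup (form_part n f) (a, b)
      = (\<Sum>c<Suc n. coeff_y n f c * (if (a, b) = (n - c, c) then 1 else 0))"
    unfolding form_part_def lookup_sum lookup_scalar lookup_form_monomial ..
  also have "\<dots> = (\<Sum>c<Suc n. if c = b then (if a = n - b then coeff_y n f b else 0) else 0)"
    by (intro sum.cong) auto
  also have "\<dots> = (if b < Suc n \<and> a = n - b then coeff_y n f b else 0)" by simp
  also have "\<dots> = (if a + b = n then Poly_Mapping.lookup f (a, b) else 0)" by auto
  finally show ?thesis .
qed

lemma kxy_eqI:
  "(\<And>a b. Poly_Mapping.lookup f (a, b) = Poly_Mapping.lookup g (a, b)) \<Longrightarrow> f = g"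
  by (rule poly_mapping_eqI) (auto split: prod.splits)

lemma form_part_add: "form_part n (f + g) = form_part n f + form_part n g"
  by (rule kxy_eqI) (simp add: lookup_form_part lookup_add)

lemma form_part_scalar: "form_part n (scalar c f) = scalar c (form_part n f)"
  by (rule kxy_eqI) (simp add: lookup_form_part)

lemma form_part_0 [simp]: "form_part n 0 = 0"
  by (rule kxy_eqI) (simp add: lookup_form_part)

lemma form_part_mem_forms: "form_part n f \<in> forms n"
  by (auto simp: forms_iff lookup_form_part split: if_splits)

lemma form_part_forms: "f \<in> forms n \<Longrightarrow> form_part m f = (if m = n then f else 0)"
  by (rule kxy_eqI) (auto simp: forms_iff lookup_form_part)

lemma form_part_monomial_mult:
  "form_part n (monomial_xy (p, q) * f)
     = (if p + q \<le> n then monomial_xy (p, q) * form_part (n - (p + q)) f else 0)"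
  by (rule kxy_eqI) (auto simp: lookup_form_part lookup_monomial_mult)

lemma sum_form_parts: "\<exists>N. f = (\<Sum>n\<le>N. form_part n f)"
proof -
  define N where "N = (\<Sum>(a, b)\<in>Poly_Mapping.keys f. a + b)"
  have N: "a + b \<le> N" if "Poly_Mapping.lookup f (a, b) \<noteq> 0" for a b
  proof -
    have "(a, b) \<in> Poly_Mapping.keys f" using that by (simp add: in_keys_iff)
    then show ?thesis
      unfolding N_def
      using member_le_sum[of "(a, b)" "Poly_Mapping.keys f" "\<lambda>(a, b). a + b"] by simp
  qed
  have "f = (\<Sum>n\<le>N. form_part n f)"
  proof (rule kxy_eqI)
    fix a b
    have "Poly_Mapping.lookup (\<Sum>n\<le>N. form_part n f) (a, b)
        = (\<Sum>n\<le>N. if a + b = n then Poly_Mapping.lookup f (a, b) else 0)"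
      by (simp only: lookup_sum lookup_form_part)
    also have "\<dots> = (if a + b \<le> N then Poly_Mapping.lookup f (a, b) else 0)"
      by simp
    also have "\<dots> = Poly_Mapping.lookup f (a, b)" using N[of a b] by auto
    finally show "Poly_Mapping.lookup f (a, b)
        = Poly_Mapping.lookup (\<Sum>n\<le>N. form_part n f) (a, b)" by simp
  qed
  then show ?thesis by blast
qed

lemma ideal_span_scalar: "f \<in> ideal.span G \<Longrightarrow> scalar c f \<in> ideal.span G"
  unfolding scalar_def by (rule ideal.span_scale)

lemma subspace_ideal_span: "kxy.subspace (ideal.span G)"
  by (intro kxy.subspaceI ideal.span_zero ideal.span_add ideal_span_scalar)

lemma kxy_expansion:
  "f = (\<Sum>m\<in>Poly_Mapping.keys f. scalar (Poly_Mapping.lookup f m) (monomial_xy m))"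
proof (rule poly_mapping_eqI)
  fix k
  have "Poly_Mapping.lookup (\<Sum>m\<in>Poly_Mapping.keys f. scalar (Poly_Mapping.lookup f m) (monomial_xy m)) k
      = (\<Sum>m\<in>Poly_Mapping.keys f. if m = k then Poly_Mapping.lookup f k else 0)"
    unfolding lookup_sum by (intro sum.cong) (auto simp: monomial_xy_def lookup_single when_def)
  also have "\<dots> = Poly_Mapping.lookup f k" by (simp add: in_keys_iff)
  finally show "Poly_Mapping.lookup f k = Poly_Mapping.lookup
      (\<Sum>m\<in>Poly_Mapping.keys f. scalar (Poly_Mapping.lookup f m) (monomial_xy m)) k" by simp
qed

lemma ideal_subspaceI:
  assumes I: "kxy.subspace I"
    and mult: "\<And>p q f. f \<in> I \<Longrightarrow> monomial_xy (p, q) * f \<in> I"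
  shows "ideal.subspace I"
proof (rule ideal.subspaceI)
  show "0 \<in> I" using I by (rule kxy.subspace_0)
  show "f + g \<in> I" if "f \<in> I" "g \<in> I" for f g using I that by (rule kxy.subspace_add)
  fix g f assume f: "f \<in> I"
  have "(\<Sum>m\<in>Poly_Mapping.keys g. scalar (Poly_Mapping.lookup g m) (monomial_xy m * f)) \<in> I"
    using mult[OF f] by (intro kxy.subspace_sum[OF I] kxy.subspace_scale[OF I]) (auto split: prod.splits)
  also have "(\<Sum>m\<in>Poly_Mapping.keys g. scalar (Poly_Mapping.lookup g m) (monomial_xy m * f)) = g * f"
    by (subst (3) kxy_expansion[of g]) (simp only: sum_distrib_right scalar_def mult.assoc)
  finally show "g * f \<in> I" .
qed

lemma graded_ideal_form_part:
  assumes "graded_ideal I" "f \<in> I"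
  shows "form_part n f \<in> I"
proof -
  obtain H where H: "H \<subseteq> (\<Union>i. forms i)" "I = ideal.span H"
    using assms(1) by (auto simp: graded_ideal_def)
  let ?J = "{f. \<forall>n. form_part n f \<in> I}"
  have "I \<subseteq> ?J"
    unfolding H(2)
  proof (rule ideal.span_minimal)
    show "H \<subseteq> {f. \<forall>n. form_part n f \<in> ideal.span H}"
    proof
      fix h assume h: "h \<in> H"
      then obtain i where "h \<in> forms i" using H(1) by auto
      then show "h \<in> {f. \<forall>n. form_part n f \<in> ideal.span H}"
        using h by (simp add: form_part_forms ideal.span_base ideal.span_zero)
    qed
    show "ideal.subspace {f. \<forall>n. form_part n f \<in> ideal.span H}"
    proof (rule ideal_subspaceI)
      show "kxy.subspace {f. \<forall>n. form_part n f \<in> ideal.span H}"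
        unfolding kxy.subspace_def
        by (simp add: form_part_add form_part_scalar ideal.span_zero ideal.span_add ideal_span_scalar)
    qed (simp add: form_part_monomial_mult ideal.span_zero ideal.span_scale)
  qed
  then show ?thesis using assms(2) by blast
qed

lemma graded_ideal_subspace: "graded_ideal I \<Longrightarrow> ideal.subspace I"
  by (auto simp: graded_ideal_def)

lemma ideal_kxy_subspace: "ideal.subspace I \<Longrightarrow> kxy.subspace I"
  by (metis subspace_ideal_span ideal.span_eq_iff)

text \<open>The ideal generated by forms \<open>V\<close> of degree \<open>d\<close> together with all forms of higher degree.\<close>

definition ideal_of_forms :: "nat \<Rightarrow> 'k::field kxy set \<Rightarrow> 'k kxy set" where
  "ideal_of_forms d V = {f. (\<forall>n<d. form_part n f = 0) \<and> form_part d f \<in> V}"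

lemma ideal_of_forms_Int_forms:
  assumes "kxy.subspace V" "V \<subseteq> forms d"
  shows "ideal_of_forms d V \<inter> forms n = (if n < d then {0} else if n = d then V else forms n)"
proof -
  have "0 \<in> V" using kxy.subspace_0 assms(1) by blast
  moreover have "(0 :: 'a kxy) \<in> forms n" by (rule kxy.subspace_0[OF subspace_forms])
  ultimately show ?thesis
    using assms(2) by (auto simp: ideal_of_forms_def form_part_forms)
qed

lemma ideal_subspace_ideal_of_forms:
  assumes V: "kxy.subspace V"
  shows "ideal.subspace (ideal_of_forms d V)"
proof (rule ideal_subspaceI)
  show "kxy.subspace (ideal_of_forms d V)"
    unfolding kxy.subspace_def ideal_of_forms_def
    by (simp add: form_part_add form_part_scalar kxy.subspace_0[OF V] kxy.subspace_add[OF V]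
        kxy.subspace_scale[OF V])
next
  fix p q and f :: "'a kxy"
  assume f: "f \<in> ideal_of_forms d V"
  show "monomial_xy (p, q) * f \<in> ideal_of_forms d V"
  proof (cases "p + q = 0")
    case True
    then have "monomial_xy (p, q) * f = f" by (intro kxy_eqI) (simp add: lookup_monomial_mult)
    then show ?thesis using f by simp
  next
    case False
    then show ?thesis
      using f kxy.subspace_0[OF V]
      by (auto simp: ideal_of_forms_def form_part_monomial_mult)
  qed
qed

lemma monomial_forms_step:
  assumes "c \<le> Suc n"
  shows "form_monomial (Suc n) c
    = (if c \<le> n then X * form_monomial n c else Y * form_monomial n (c - 1))"
proof (cases "c \<le> n")
  case True
  then show ?thesis
    by (auto intro!: poly_mapping_eqI simp: form_monomial_def monomial_xy_def
        mult_single Suc_diff_le)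
next
  case False
  then have "c = Suc n" using assms by simp
  then show ?thesis
    by (auto intro!: poly_mapping_eqI simp: form_monomial_def monomial_xy_def mult_single)
qed

lemma forms_subset_ideal_span_step:
  assumes "forms n \<subseteq> ideal.span H"
  shows "forms (Suc n) \<subseteq> ideal.span H"
proof -
  have mem: "form_monomial n c \<in> ideal.span H" if "c \<le> n" for c
    using that assms form_monomial_mem[of c "Suc n" n] by (auto simp: forms_eq_low_forms)
  have "form_monomial (Suc n) c \<in> ideal.span H" if c: "c \<le> Suc n" for c
    unfolding monomial_forms_step[OF c] using c by (auto intro!: ideal.span_scale mem)
  then have "form_monomial (Suc n) ` {..<Suc (Suc n)} \<subseteq> ideal.span H" by auto
  then have "kxy.span (form_monomial (Suc n) ` {..<Suc (Suc n)}) \<subseteq> ideal.span H"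
    by (rule kxy.span_minimal[OF _ subspace_ideal_span])
  then show ?thesis using forms_finite(2)[of "Suc n"] by (rule order_trans[rotated])
qed

text \<open>
  Homogeneous components reduce membership in the ideal to single degrees, and all forms of degree
  above \<open>d + 1\<close> are multiples of forms of degree \<open>d + 1\<close>.
\<close>

lemma ideal_span_eq_ideal_of_forms:
  assumes V: "kxy.subspace V" and H: "H \<subseteq> ideal_of_forms d V"
    and gen: "V \<subseteq> ideal.span H" "forms (Suc d) \<subseteq> ideal.span H"
  shows "ideal.span H = ideal_of_forms d V"
proof
  show "ideal.span H \<subseteq> ideal_of_forms d V"
    by (rule ideal.span_minimal[OF H ideal_subspace_ideal_of_forms[OF V]])
  have high: "forms n \<subseteq> ideal.span H" if "n > d" for n
    using Suc_leI[OF that]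
  proof (induction n rule: dec_induct)
    case base
    show ?case by (rule gen(2))
  next
    case (step n)
    then show ?case by (intro forms_subset_ideal_span_step)
  qed
  show "ideal_of_forms d V \<subseteq> ideal.span H"
  proof
    fix f assume f: "f \<in> ideal_of_forms d V"
    have "form_part n f \<in> ideal.span H" for n
    proof (cases n d rule: linorder_cases)
      case less
      then show ?thesis using f by (simp add: ideal_of_forms_def ideal.span_zero)
    next
      case equal
      then show ?thesis using f gen(1) by (auto simp: ideal_of_forms_def)
    next
      case greater
      then show ?thesis using high form_part_mem_forms by blast
    qed
    moreover obtain N where "f = (\<Sum>n\<le>N. form_part n f)" using sum_form_parts by blast
    ultimately show "f \<in> ideal.span H" by (metis ideal.span_sum)
  qed
qed

lemma graded_ideal_ideal_of_forms:
  assumes V: "kxy.subspace V" "V \<subseteq> forms d"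
  shows "graded_ideal (ideal_of_forms d V)"
proof -
  let ?H = "V \<union> forms (Suc d)"
  have "?H \<subseteq> ideal_of_forms d V"
    using ideal_of_forms_Int_forms[OF V, of d] ideal_of_forms_Int_forms[OF V, of "Suc d"] by auto
  then have "ideal.span ?H = ideal_of_forms d V"
    using ideal.span_superset[of ?H] by (intro ideal_span_eq_ideal_of_forms V(1)) auto
  moreover have "?H \<subseteq> (\<Union>i. forms i)" using V(2) by auto
  ultimately show ?thesis unfolding graded_ideal_def by (intro exI[of _ ?H]) simp
qed

lemma graded_ideal_eq_ideal_of_forms:
  assumes I: "graded_ideal I"
    and low: "\<And>n. n < d \<Longrightarrow> I \<inter> forms n = {0}"
    and high: "\<And>n. d < n \<Longrightarrow> forms n \<subseteq> I"
  shows "I = ideal_of_forms d (I \<inter> forms d)"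
proof -
  have sub: "kxy.subspace (I \<inter> forms d)"
    by (intro kxy.subspace_inter subspace_forms ideal_kxy_subspace graded_ideal_subspace I)
  have "ideal.span I = ideal_of_forms d (I \<inter> forms d)"
  proof (rule ideal_span_eq_ideal_of_forms[OF sub])
    show "I \<subseteq> ideal_of_forms d (I \<inter> forms d)"
    proof
      fix f assume f: "f \<in> I"
      have mem: "form_part n f \<in> I \<inter> forms n" for n
        using graded_ideal_form_part[OF I f] form_part_mem_forms by blast
      then have "form_part n f = 0" if "n < d" for n using low[OF that] mem[of n] by simp
      then show "f \<in> ideal_of_forms d (I \<inter> forms d)"
        using mem[of d] by (simp add: ideal_of_forms_def)
    qed
    show "I \<inter> forms d \<subseteq> ideal.span I" using ideal.span_superset[of I] by blast
    show "forms (Suc d) \<subseteq> ideal.span I" using high[of "Suc d"] ideal.span_superset[of I] by simp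
  qed
  then show ?thesis using ideal.span_eq_iff graded_ideal_subspace[OF I] by metis
qed

section \<open>The number of generators\<close>

lemma form_part_span:
  assumes "f \<in> kxy.span A"
  shows "form_part n f \<in> kxy.span (form_part n ` A)"
proof -
  have "kxy.span A \<subseteq> {f. form_part n f \<in> kxy.span (form_part n ` A)}"
  proof (rule kxy.span_minimal)
    show "A \<subseteq> {f. form_part n f \<in> kxy.span (form_part n ` A)}"
      by (auto intro: kxy.span_base)
    show "kxy.subspace {f. form_part n f \<in> kxy.span (form_part n ` A)}"
      unfolding kxy.subspace_def
      by (simp add: kxy.span_zero form_part_add kxy.span_add form_part_scalar kxy.span_scale)
  qed
  then show ?thesis using assms by blast
qed

lemma dim_Un_forms:
  assumes "U \<subseteq> forms n" "W \<subseteq> forms m" "n \<noteq> m"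
  shows "kxy.dim (U \<union> W) \<ge> kxy.dim U + kxy.dim W"
proof -
  let ?F = "form_monomial n ` {..<Suc n}" and ?F' = "form_monomial m ` {..<Suc m}"
  have fin: "finite (?F \<union> ?F')" by simp
  have U: "U \<subseteq> kxy.span ?F" using assms(1) forms_finite(2) by (rule order_trans)
  have W: "W \<subseteq> kxy.span ?F'" using assms(2) forms_finite(2) by (rule order_trans)
  have UW: "U \<union> W \<subseteq> kxy.span (?F \<union> ?F')"
    using U W kxy.span_mono[of ?F "?F \<union> ?F'"] kxy.span_mono[of ?F' "?F \<union> ?F'"] by blast
  obtain B where B: "B \<subseteq> U" "kxy.independent B" "card B = kxy.dim U" "finite B"
    by (rule kxy.finite_basis_obtain[OF _ U]) simp_all
  have "kxy.dim (B \<union> W) = card B + kxy.dim W"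
    using B(4,1,2)
  proof (induction B)
    case empty
    then show ?case by simp
  next
    case (insert b B)
    have "b \<notin> kxy.span (B \<union> W)"
    proof
      assume "b \<in> kxy.span (B \<union> W)"
      then have "form_part n b \<in> kxy.span (form_part n ` (B \<union> W))" by (rule form_part_span)
      moreover have "form_part n ` (B \<union> W) \<subseteq> insert 0 B"
      proof -
        have "form_part n f = f" if "f \<in> B" for f
          using that insert.prems(1) assms(1) form_part_forms[of f n n] by auto
        moreover have "form_part n f = 0" if "f \<in> W" for f
          using that assms(2,3) form_part_forms[of f m n] by auto
        ultimately show ?thesis by auto
      qed
      ultimately have "form_part n b \<in> kxy.span (insert 0 B)"
        using kxy.span_mono by blast
      moreover have "form_part n b = b"
        using insert.prems(1) assms(1) form_part_forms[of b n n] by auto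
      ultimately have "b \<in> kxy.span B" by (simp add: kxy.span_insert_0)
      then show False using insert.prems(2) insert.hyps(2)
        by (simp add: kxy.independent_insert)
    qed
    moreover have "B \<union> W \<subseteq> kxy.span (?F \<union> ?F')" using UW insert.prems(1) by blast
    ultimately have "kxy.dim (insert b (B \<union> W)) = Suc (kxy.dim (B \<union> W))"
      by (intro kxy.dim_insert_of_finite[OF fin])
    moreover have "kxy.independent B"
      using insert.prems(2) kxy.independent_mono by blast
    ultimately show ?case using insert by simp
  qed
  moreover have "B \<union> W \<subseteq> U \<union> W" using B(1) by blast
  then have "kxy.dim (B \<union> W) \<le> kxy.dim (U \<union> W)"
    by (rule kxy.dim_subset_of_finite[OF fin UW])
  ultimately show ?thesis using B(3) by simp
qed

text \<open>
  Up to degree \<open>d + 1\<close>, a multiple of an element of the ideal is a scalar multiple plus the product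
  of its component of degree \<open>d\<close> with a linear form, since there are no components below \<open>d\<close>.
\<close>

lemma truncation_span:
  assumes V: "kxy.subspace V" "V \<subseteq> forms d"
    and G: "ideal.span G = ideal_of_forms d V" and f: "f \<in> ideal_of_forms d V"
  shows "form_part d f + form_part (Suc d) f
    \<in> kxy.span ((\<lambda>g. form_part d g + form_part (Suc d) g) ` G \<union> linear_multiples V)"
proof -
  let ?t = "\<lambda>g :: 'a kxy. form_part d g + form_part (Suc d) g"
  let ?S = "kxy.span (?t ` G \<union> linear_multiples V)"
  let ?J = "{f \<in> ideal_of_forms d V. ?t f \<in> ?S}"
  have Isub: "ideal.subspace (ideal_of_forms d V)" by (rule ideal_subspace_ideal_of_forms[OF V(1)])
  note Iksub = ideal_kxy_subspace[OF Isub]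
  have t_add: "?t (f + g) = ?t f + ?t g" for f g by (simp add: form_part_add)
  have t_scalar: "?t (scalar c f) = scalar c (?t f)" for c f
    by (simp add: form_part_scalar kxy.scale_right_distrib)
  have lm: "linear_multiples V \<subseteq> ?S" using kxy.span_superset[of "?t ` G \<union> linear_multiples V"] by blast
  have "ideal.span G \<subseteq> ?J"
  proof (rule ideal.span_minimal)
    show "G \<subseteq> ?J" using G ideal.span_superset[of G] by (auto intro: kxy.span_base)
    show "ideal.subspace ?J"
    proof (rule ideal_subspaceI)
      show "kxy.subspace ?J"
      proof (rule kxy.subspaceI)
        show "0 \<in> ?J" using kxy.subspace_0[OF Iksub] by (simp add: kxy.span_zero)
        show "f + g \<in> ?J" if "f \<in> ?J" "g \<in> ?J" for f g
          using that kxy.subspace_add[OF Iksub] kxy.span_add[of "?t f" _ "?t g"]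
          unfolding t_add mem_Collect_eq by blast
        show "scalar c f \<in> ?J" if "f \<in> ?J" for c f
          using that kxy.subspace_scale[OF Iksub] kxy.span_scale[of "?t f"]
          unfolding t_scalar mem_Collect_eq by blast
      qed
      fix p q f assume f: "f \<in> ?J"
      then have fd: "form_part d f \<in> V" and fl: "\<And>n. n < d \<Longrightarrow> form_part n f = 0"
        by (auto simp: ideal_of_forms_def)
      have "?t (monomial_xy (p, q) * f) \<in> ?S"
      proof (cases "p + q" "1 :: nat" rule: linorder_cases)
        case less
        then have "monomial_xy (p, q) * f = f" by (intro kxy_eqI) (simp add: lookup_monomial_mult)
        then show ?thesis using f by simp
      next
        case equal
        then have "?t (monomial_xy (p, q) * f) = monomial_xy (p, q) * form_part d f"
          by (simp add: form_part_monomial_mult fl)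
        moreover have "(p, q) = (1, 0) \<or> (p, q) = (0, 1)" using equal by auto
        then have "monomial_xy (p, q) * form_part d f \<in> linear_multiples V"
          unfolding linear_multiples_def using fd by (intro kxy.span_base) auto
        ultimately show ?thesis using lm by auto
      next
        case greater
        then have "?t (monomial_xy (p, q) * f) = 0"
          by (simp add: form_part_monomial_mult fl)
        then show ?thesis by (simp add: kxy.span_zero)
      qed
      moreover have "monomial_xy (p, q) * f \<in> ideal_of_forms d V"
        using f ideal.subspace_scale[OF Isub] by blast
      ultimately show "monomial_xy (p, q) * f \<in> ?J" by blast
    qed
  qed
  then show ?thesis using f G by blast
qed

text \<open>
  A basis of \<open>V\<close> and a complement of its multiples in degree \<open>d + 1\<close> generate the ideal. No
  smaller set does: truncated after degree \<open>d + 1\<close>, the ideal has dimension \<open>dim V + d + 2\<close>, and it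
  is spanned by the truncated generators and the multiples of \<open>V\<close>.
\<close>

lemma min_gens_ideal_of_forms:
  assumes V: "kxy.subspace V" "V \<subseteq> forms d"
  shows "min_gens (ideal_of_forms d V) + kxy.dim (linear_multiples V) = kxy.dim V + d + 2"
proof -
  let ?R = "linear_multiples V" and ?n = "kxy.dim V + (d + 2 - kxy.dim (linear_multiples V))"
  let ?F = "form_monomial (Suc d) ` {..<Suc (Suc d)} :: 'a kxy set"
  note fin = forms_finite(1)[of "Suc d"] and sp = forms_finite(2)[of "Suc d"]
  have R: "?R \<subseteq> forms (Suc d)" by (rule linear_multiples_subset_forms[OF V(2)])
  have dimR: "kxy.dim ?R \<le> d + 2"
    using kxy.dim_subset_of_finite[OF fin sp R] by (simp add: dim_forms)
  have Rsp: "?R \<subseteq> kxy.span ?F" using R sp by (rule order_trans)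
  obtain D where D: "D \<subseteq> ?R" "kxy.independent D" "?R \<subseteq> kxy.span D" "card D = kxy.dim ?R" "finite D"
    by (rule kxy.finite_basis_obtain[OF fin Rsp])
  have Vsp: "V \<subseteq> kxy.span (form_monomial d ` {..<Suc d})"
    using V(2) forms_finite(2) by (rule order_trans)
  obtain B where B: "B \<subseteq> V" "V \<subseteq> kxy.span B" "card B = kxy.dim V" "finite B"
    by (rule kxy.finite_basis_obtain[OF forms_finite(1) Vsp])
  have parts: "V \<subseteq> ideal_of_forms d V" "forms (Suc d) \<subseteq> ideal_of_forms d V"
    using ideal_of_forms_Int_forms[OF V, of d] ideal_of_forms_Int_forms[OF V, of "Suc d"] by auto
  have lower: "?n \<le> card G" if G: "finite G" "ideal.span G = ideal_of_forms d V" for G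
  proof -
    let ?t = "\<lambda>g :: 'a kxy. form_part d g + form_part (Suc d) g"
    have "kxy.span (?t ` G \<union> ?R) \<subseteq> kxy.span (?t ` G \<union> D)"
      using D(3) kxy.span_superset[of "?t ` G"] kxy.span_mono[of D "?t ` G \<union> D"]
        kxy.span_mono[of "?t ` G" "?t ` G \<union> D"]
      by (intro kxy.span_minimal kxy.subspace_span) blast
    then have t: "?t f \<in> kxy.span (?t ` G \<union> D)" if "f \<in> ideal_of_forms d V" for f
      using truncation_span[OF V G(2) that] by blast
    have "V \<union> forms (Suc d) \<subseteq> kxy.span (?t ` G \<union> D)"
    proof
      fix f assume f: "f \<in> V \<union> forms (Suc d)"
      then have "?t f = f" using V(2) by (auto simp: form_part_forms)
      moreover have "f \<in> ideal_of_forms d V" using f parts by blast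
      ultimately show "f \<in> kxy.span (?t ` G \<union> D)" using t[of f] by simp
    qed
    then have "kxy.dim (V \<union> forms (Suc d)) \<le> card (?t ` G \<union> D)"
      using G(1) D(5) by (intro kxy.dim_le_card) auto
    also have "\<dots> \<le> card G + card D"
      using card_Un_le[of "?t ` G" D] card_image_le[OF G(1), of ?t] by linarith
    finally have "kxy.dim V + kxy.dim (forms (Suc d) :: 'a kxy set) \<le> card G + card D"
      using dim_Un_forms[OF V(2), of "forms (Suc d)" "Suc d"] by simp
    then show ?thesis using D(4) dimR by (simp add: dim_forms)
  qed
  obtain E where E: "D \<subseteq> E" "E \<subseteq> forms (Suc d)" "kxy.independent E" "forms (Suc d) \<subseteq> kxy.span E"
    by (rule kxy.maximal_independent_subset_extend[OF order_trans[OF D(1) R] D(2)])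
  have Efin: "finite E" and "card E = d + 2"
    using kxy.independent_card_le_dim_of_finite[OF fin sp E(2,3)]
      kxy.basis_card_eq_dim[OF E(2,4,3)] by (simp_all add: dim_forms)
  then have card: "card (E - D) = d + 2 - kxy.dim ?R"
    using E(1) D by (simp add: card_Diff_subset)
  let ?H = "B \<union> (E - D)"
  have Hsub: "?H \<subseteq> ideal_of_forms d V" using B(1) E(2) parts by blast
  have HV: "V \<subseteq> ideal.span ?H"
  proof -
    have "B \<subseteq> ideal.span ?H" using ideal.span_superset[of ?H] by blast
    then have "kxy.span B \<subseteq> ideal.span ?H" by (rule kxy.span_minimal[OF _ subspace_ideal_span])
    then show ?thesis using B(2) by blast
  qed
  have "?R \<subseteq> ideal.span ?H"
    unfolding linear_multiples_def
    by (rule kxy.span_minimal[OF _ subspace_ideal_span]) (use HV in \<open>auto intro: ideal.span_scale\<close>)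
  then have "E \<subseteq> ideal.span ?H" using D(1) ideal.span_superset[of ?H] by blast
  then have "kxy.span E \<subseteq> ideal.span ?H" by (rule kxy.span_minimal[OF _ subspace_ideal_span])
  then have "forms (Suc d) \<subseteq> ideal.span ?H" using E(4) by blast
  then have H: "ideal.span ?H = ideal_of_forms d V"
    by (rule ideal_span_eq_ideal_of_forms[OF V(1) Hsub HV])
  have Hfin: "finite ?H" using B(4) Efin by blast
  have cardH: "card ?H = ?n"
    using lower[OF Hfin H] card_Un_le[of B "E - D"] B(3) card by linarith
  have "min_gens (ideal_of_forms d V) = ?n"
    unfolding min_gens_def
  proof (rule Least_equality)
    show "\<exists>G. finite G \<and> card G = ?n \<and> ideal.span G = ideal_of_forms d V"
      using Hfin cardH H by blast
  qed (use lower in blast)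
  then show ?thesis using dimR by simp
qed

section \<open>Polynomial conditions\<close>

lemma poly_fun_sum:
  assumes "\<And>i. i \<in> A \<Longrightarrow> poly_fun (F i)"
  shows "poly_fun (\<lambda>z. \<Sum>i\<in>A. F i z)"
proof (cases "finite A")
  case True
  then show ?thesis using assms
    by (induction A) (auto intro: poly_fun.intros)
qed (simp add: poly_fun.const)

lemma poly_fun_prod:
  assumes "\<And>i. i \<in> A \<Longrightarrow> poly_fun (F i)"
  shows "poly_fun (\<lambda>z. \<Prod>i\<in>A. F i z)"
proof (cases "finite A")
  case True
  then show ?thesis using assms
    by (induction A) (auto intro: poly_fun.intros)
qed (simp add: poly_fun.const)

lemma poly_fun_compose:
  assumes "poly_fun F" "\<And>v. poly_fun (\<lambda>z. G z v)"
  shows "poly_fun (\<lambda>z. F (G z))"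
  using assms(1) by induction (use assms(2) in \<open>auto intro: poly_fun.intros\<close>)

lemma poly_fun_det:
  assumes "\<And>i j. i < r \<Longrightarrow> j < r \<Longrightarrow> poly_fun (\<lambda>z. A z i j)"
  shows "poly_fun (\<lambda>z. det (mat r r (\<lambda>(i, j). A z i j)))"
proof -
  have "(\<lambda>z. det (mat r r (\<lambda>(i, j). A z i j)))
      = (\<lambda>z. \<Sum>p\<in>{p. p permutes {0..<r}}. signof p * (\<Prod>i = 0..<r. A z i (p i)))"
    by (subst det_def'[of _ r])
      (auto simp: permutes_in_image intro!: ext sum.cong prod.cong arg_cong2[where f = "(*)"])
  moreover have "poly_fun (\<lambda>z. \<Sum>p\<in>{p. p permutes {0..<r}}. signof p * (\<Prod>i = 0..<r. A z i (p i)))"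
    by (intro poly_fun_sum poly_fun.mult poly_fun.const poly_fun_prod assms)
      (auto dest: permutes_in_image)
  ultimately show ?thesis by simp
qed

text \<open>
  Polynomial functions with variables indexed by the one-point type are the polynomials in one
  variable; they will be restrictions of polynomial conditions to lines.
\<close>

lemma poly_fun_one_variable:
  fixes F :: "(unit \<Rightarrow> 'k::field) \<Rightarrow> 'k"
  assumes "poly_fun F"
  shows "\<exists>p. \<forall>l. F (\<lambda>_. l) = poly p l"
  using assms
proof induction
  case (const c)
  show ?case by (intro exI[of _ "[:c:]"]) simp
next
  case (var v)
  show ?case by (intro exI[of _ "[:0, 1:]"]) simp
next
  case (add F G)
  then show ?case by (metis poly_add)
next
  case (mult F G)
  then show ?case by (metis poly_mult)
qed

lemma poly_fun_common_nonzero: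
  fixes \<F> :: "((unit \<Rightarrow> 'k::field) \<Rightarrow> 'k) set"
  assumes inf: "infinite (UNIV :: 'k set)" and fin: "finite \<F>"
    and F: "\<And>F. F \<in> \<F> \<Longrightarrow> poly_fun F" "\<And>F. F \<in> \<F> \<Longrightarrow> \<exists>l. F (\<lambda>_. l) \<noteq> 0"
  shows "\<exists>l. \<forall>F\<in>\<F>. F (\<lambda>_. l) \<noteq> 0"
proof -
  have "finite {l. F (\<lambda>_. l) = 0}" if "F \<in> \<F>" for F
  proof -
    have "\<exists>p. \<forall>l. F (\<lambda>_. l) = poly p l" by (rule poly_fun_one_variable[OF F(1)[OF that]])
    then obtain p where p: "\<forall>l. F (\<lambda>_. l) = poly p l" by blast
    then have "p \<noteq> 0" using F(2)[OF that] by auto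
    then show ?thesis using p poly_roots_finite[of p] by simp
  qed
  then have "finite (\<Union>F\<in>\<F>. {l. F (\<lambda>_. l) = 0})" using fin by blast
  then have "(\<Union>F\<in>\<F>. {l. F (\<lambda>_. l) = 0}) \<noteq> UNIV" using inf by metis
  then show ?thesis by blast
qed

text \<open>
  The matrix of the values of \<open>r\<close> linear functionals on \<open>r\<close> forms, where \<open>\<phi> j b\<close> is the value of
  the functional \<open>\<phi> j\<close> on a monomial. Its determinant is a polynomial in the coefficients of the
  forms, and as \<open>\<phi>\<close> varies it detects linear independence.
\<close>

definition form_det :: "nat \<Rightarrow> nat \<Rightarrow> (nat \<Rightarrow> nat \<Rightarrow> 'k) \<Rightarrow> (nat \<Rightarrow> 'k::field kxy) \<Rightarrow> 'k" where
  "form_det n r \<phi> u = det (mat r r (\<lambda>(j, i). \<Sum>b<Suc n. \<phi> j b * coeff_y n (u i) b))"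

definition independent_family :: "nat \<Rightarrow> (nat \<Rightarrow> 'k::field kxy) \<Rightarrow> bool" where
  "independent_family r u \<longleftrightarrow> inj_on u {..<r} \<and> kxy.independent (u ` {..<r})"

lemma independent_family_iff_dim:
  "independent_family r u \<longleftrightarrow> kxy.dim (kxy.span (u ` {..<r})) = r"
proof
  assume "independent_family r u"
  then show "kxy.dim (kxy.span (u ` {..<r})) = r"
    unfolding independent_family_def kxy.dim_span
    by (simp add: kxy.dim_eq_card_independent card_image)
next
  assume "kxy.dim (kxy.span (u ` {..<r})) = r"
  then have r: "kxy.dim (u ` {..<r}) = r" by simp
  obtain B where B: "B \<subseteq> u ` {..<r}" "kxy.independent B" "card B = r"
    using r by (metis kxy.basis_exists)
  have le: "card (u ` {..<r}) \<le> r" using card_image_le[of "{..<r}" u] by simp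
  then have "B = u ` {..<r}" using B by (intro card_seteq) simp_all
  then show "independent_family r u"
    using B eq_card_imp_inj_on[of "{..<r}" u] by (simp add: independent_family_def)
qed

lemma independent_familyI:
  assumes "\<And>c i. (\<Sum>i<r. scalar (c i) (u i)) = 0 \<Longrightarrow> i < r \<Longrightarrow> c i = 0"
  shows "independent_family r u"
  unfolding independent_family_def
proof
  show inj: "inj_on u {..<r}"
  proof (rule inj_onI, rule ccontr)
    fix i j assume ij: "i \<in> {..<r}" "j \<in> {..<r}" "u i = u j" "i \<noteq> j"
    let ?c = "\<lambda>k. if k = i then 1 else if k = j then - 1 else 0 :: 'a"
    have "(\<Sum>k<r. scalar (?c k) (u k)) = (\<Sum>k\<in>{i, j}. scalar (?c k) (u k))"
      using ij by (intro sum.mono_neutral_right) auto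
    also have "\<dots> = 0" using ij by (simp add: kxy.scale_minus_left)
    finally have "?c i = 0" using assms[of ?c i] ij(1) by simp
    then show False by simp
  qed
  show "kxy.independent (u ` {..<r})"
  proof
    assume "kxy.dependent (u ` {..<r})"
    then obtain a v where a: "v \<in> u ` {..<r}" "a v \<noteq> 0" "(\<Sum>v\<in>u ` {..<r}. scalar (a v) v) = 0"
      unfolding kxy.dependent_finite[OF finite_imageI[OF finite_lessThan]] by blast
    have "(\<Sum>i<r. scalar (a (u i)) (u i)) = 0" using a(3) by (simp add: sum.reindex[OF inj])
    then have "a (u i) = 0" if "i < r" for i using assms[of "\<lambda>i. a (u i)"] that by blast
    then show False using a by auto
  qed
qed

lemma independent_family_of_form_det:
  assumes u: "\<And>i. i < r \<Longrightarrow> u i \<in> forms n" and nz: "form_det n r \<phi> u \<noteq> 0"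
  shows "independent_family r u"
proof (rule independent_familyI, rule ccontr)
  fix c i assume c: "(\<Sum>i<r. scalar (c i) (u i)) = 0" "i < r" "c i \<noteq> 0"
  let ?A = "mat r r (\<lambda>(j, i). \<Sum>b<Suc n. \<phi> j b * coeff_y n (u i) b)"
  let ?v = "vec r c"
  have "?v \<noteq> 0\<^sub>v r" using c(2,3) by (metis index_vec index_zero_vec(1))
  moreover have "?A *\<^sub>v ?v = 0\<^sub>v r"
  proof (rule eq_vecI)
    fix j assume j: "j < dim_vec (0\<^sub>v r :: 'a vec)"
    have "(?A *\<^sub>v ?v) $ j = (\<Sum>i<r. (\<Sum>b<Suc n. \<phi> j b * coeff_y n (u i) b) * c i)"
      using j by (simp add: scalar_prod_def lessThan_atLeast0)
    also have "\<dots> = (\<Sum>i<r. \<Sum>b<Suc n. \<phi> j b * (c i * coeff_y n (u i) b))"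
      by (intro sum.cong refl, subst sum_distrib_right, intro sum.cong refl) simp
    also have "\<dots> = (\<Sum>b<Suc n. \<phi> j b * (\<Sum>i<r. c i * coeff_y n (u i) b))"
      by (subst sum.swap) (simp add: sum_distrib_left del: sum.lessThan_Suc)
    also have "\<dots> = (\<Sum>b<Suc n. \<phi> j b * coeff_y n (\<Sum>i<r. scalar (c i) (u i)) b)"
      by (simp add: lookup_sum del: sum.lessThan_Suc)
    also have "\<dots> = 0" unfolding c(1) by simp
    finally show "(?A *\<^sub>v ?v) $ j = 0\<^sub>v r $ j" using j by simp
  qed simp
  ultimately have "det ?A = 0"
    by (subst det_0_iff_vec_prod_zero[of _ r]) (auto intro: exI[of _ ?v])
  then show False using nz by (simp add: form_det_def)
qed

text \<open>
  The functionals are the coordinate functions with respect to a basis that extends the family,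
  so that the matrix is the identity.
\<close>

lemma exists_form_det_nonzero:
  assumes u: "\<And>i. i < r \<Longrightarrow> u i \<in> forms n" and ind: "independent_family r u"
  shows "\<exists>\<phi>. form_det n r \<phi> u \<noteq> 0"
proof -
  let ?B = "kxy.extend_basis (u ` {..<r})"
  have I: "kxy.independent (u ` {..<r})" and inj: "inj_on u {..<r}"
    using ind by (auto simp: independent_family_def)
  have B: "kxy.independent ?B" "kxy.span ?B = UNIV" "u ` {..<r} \<subseteq> ?B"
    using kxy.independent_extend_basis[OF I] kxy.span_extend_basis[OF I]
      kxy.extend_basis_superset[OF I] by blast+
  define \<phi> where "\<phi> j b = kxy.representation ?B (form_monomial n b) (u j)" for j b
  have "(\<Sum>b<Suc n. \<phi> j b * coeff_y n (u i) b) = (if j = i then 1 else 0)" if "i < r" "j < r" for i j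
  proof -
    have "(\<Sum>b<Suc n. \<phi> j b * coeff_y n (u i) b)
        = (\<Sum>b<Suc n. kxy.representation ?B (scalar (coeff_y n (u i) b) (form_monomial n b)) (u j))"
      by (intro sum.cong refl) (simp add: \<phi>_def kxy.representation_scale[OF B(1)] B(2) mult.commute)
    also have "\<dots> = kxy.representation ?B
        (\<Sum>b<Suc n. scalar (coeff_y n (u i) b) (form_monomial n b)) (u j)"
      by (subst kxy.representation_sum[OF B(1)]) (simp_all add: B(2) del: sum.lessThan_Suc)
    also have "(\<Sum>b<Suc n. scalar (coeff_y n (u i) b) (form_monomial n b)) = u i"
      using u[OF that(1)] by (intro low_forms_expansion[symmetric]) (simp add: forms_eq_low_forms)
    also have "kxy.representation ?B (u i) (u j) = (if u j = u i then 1 else 0)"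
      using B(3) that(1) by (subst kxy.representation_basis[OF B(1)]) auto
    also have "u j = u i \<longleftrightarrow> j = i" using inj that by (auto simp: inj_on_def)
    finally show ?thesis .
  qed
  then have "mat r r (\<lambda>(j, i). \<Sum>b<Suc n. \<phi> j b * coeff_y n (u i) b) = 1\<^sub>m r"
    by (intro eq_matI) (auto simp del: sum.lessThan_Suc)
  then have "form_det n r \<phi> u \<noteq> 0" unfolding form_det_def by simp
  then show ?thesis by blast
qed

section \<open>Frames and generic values\<close>

text \<open>
  Extends a basis \<open>u\<close> of \<open>V\<close> to a frame of \<open>ideal_of_forms d V\<close> that does not depend on \<open>V\<close> in
  other degrees, so that a line of bases gives a line of frames.
\<close>

definition standard_frame :: "nat \<Rightarrow> nat \<Rightarrow> (nat \<Rightarrow> 'k::field kxy) \<Rightarrow> nat \<Rightarrow> nat \<Rightarrow> 'k kxy" where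
  "standard_frame d s u = (\<lambda>i j. if i = d \<and> j < s then u j
     else if d < i \<and> j \<le> i then form_monomial i j else 0)"

lemma span_form_monomials: "kxy.span (form_monomial n ` {..<Suc n}) = forms n"
proof
  have "form_monomial n ` {..<Suc n} \<subseteq> forms n"
    by (auto simp: forms_eq_low_forms intro!: form_monomial_mem)
  then show "kxy.span (form_monomial n ` {..<Suc n}) \<subseteq> forms n"
    by (rule kxy.span_minimal[OF _ subspace_forms])
qed (rule forms_finite(2))

lemma ideal_frame_standard_frame:
  assumes u: "independent_family s u" and V: "V = kxy.span (u ` {..<s})" "V \<subseteq> forms d"
  shows "ideal_frame (ideal_of_forms d V) (standard_frame d s u)"
proof -
  have dimV: "kxy.dim V = s" using u unfolding V(1) independent_family_iff_dim .
  have sub: "kxy.subspace V" unfolding V(1) by simp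
  note Int = ideal_of_forms_Int_forms[OF sub V(2)]
  have mon: "independent_family (Suc n) (form_monomial n :: nat \<Rightarrow> 'a kxy)" for n
    unfolding independent_family_iff_dim span_form_monomials by (rule dim_forms)
  show ?thesis
    unfolding ideal_frame_def Let_def
  proof
    fix i
    let ?n = "kxy.dim (ideal_of_forms d V \<inter> forms i)" and ?f = "standard_frame d s u i"
    consider "i < d" | "i = d" | "d < i" by linarith
    then show "inj_on ?f {..<?n} \<and> kxy.independent (?f ` {..<?n}) \<and>
        kxy.span (?f ` {..<?n}) = ideal_of_forms d V \<inter> forms i \<and> (\<forall>j\<ge>?n. ?f j = 0)"
    proof cases
      case 1
      have "kxy.dim {0 :: 'a kxy} = 0"
        using dim_low_forms[of 0 0, where ?'k = 'a] kxy.dim_le_card[of "{0}" "{}"] by simp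
      then show ?thesis using 1 by (simp add: Int standard_frame_def kxy.independent_empty)
    next
      case 2
      then have n: "?n = s" by (simp add: Int dimV)
      have f: "?f j = u j" if "j < s" for j using 2 that by (simp add: standard_frame_def)
      have "\<forall>j\<ge>s. ?f j = 0" using 2 by (simp add: standard_frame_def)
      moreover have "?f ` {..<s} = u ` {..<s}" using f by (intro image_cong) auto
      moreover have "inj_on ?f {..<s} = inj_on u {..<s}" using f by (intro inj_on_cong) auto
      moreover have "ideal_of_forms d V \<inter> forms i = V" using 2 by (simp add: Int)
      ultimately show ?thesis
        unfolding n using u V(1) by (simp only: independent_family_def simp_thms)
    next
      case 3
      then have n: "?n = Suc i" by (simp add: Int dim_forms)
      have f: "?f j = form_monomial i j" if "j < Suc i" for j
        using 3 that by (simp add: standard_frame_def)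
      have "\<forall>j\<ge>Suc i. ?f j = 0" using 3 by (simp add: standard_frame_def)
      moreover have "?f ` {..<Suc i} = form_monomial i ` {..<Suc i}"
        using f by (intro image_cong) auto
      moreover have "inj_on ?f {..<Suc i} = inj_on (form_monomial i :: nat \<Rightarrow> 'a kxy) {..<Suc i}"
        using f by (intro inj_on_cong) auto
      moreover have "ideal_of_forms d V \<inter> forms i = forms i" using 3 by (simp add: Int)
      ultimately show ?thesis
        unfolding n using mon[of i]
        by (simp only: independent_family_def span_form_monomials simp_thms)
    qed
  qed
qed

lemma frame_of_ideal_of_forms:
  assumes V: "kxy.subspace V" "V \<subseteq> forms d" "kxy.dim V = s"
    and v: "ideal_frame (ideal_of_forms d V) v"
  shows "kxy.span (v d ` {..<s}) = V" "independent_family s (v d)"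
proof -
  have "ideal_of_forms d V \<inter> forms d = V" by (simp add: ideal_of_forms_Int_forms[OF V(1,2)])
  then show "kxy.span (v d ` {..<s}) = V" "independent_family s (v d)"
    using v V(3) unfolding ideal_frame_def Let_def independent_family_def by metis+
qed

text \<open>
  Any two members have bases that are joined by a line of bases of members, up to the parameters
  where the family of vectors on the line becomes dependent.
\<close>

definition line_connected :: "nat \<Rightarrow> 'k::field kxy set set \<Rightarrow> bool" where
  "line_connected s \<V> \<longleftrightarrow> (\<forall>V\<in>\<V>. \<forall>W\<in>\<V>. \<exists>v w. V = kxy.span (v ` {..<s}) \<and> W = kxy.span (w ` {..<s}) \<and>
     (\<forall>l. let u = (\<lambda>j. scalar (1 - l) (v j) + scalar l (w j)) in
        independent_family s u \<longrightarrow> kxy.span (u ` {..<s}) \<in> \<V>))"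

text \<open>
  A line-connected family is irreducible: two polynomial conditions that can be met at the two ends
  of a line restrict to nonzero polynomials in the parameter, so they can be met at once.
\<close>

lemma open_sets_meet:
  fixes \<V> :: "'k::field kxy set set"
  assumes inf: "infinite (UNIV :: 'k set)"
    and \<V>: "\<And>V. V \<in> \<V> \<Longrightarrow> V \<subseteq> forms d \<and> kxy.dim V = s"
    and line: "line_connected s \<V>"
    and U: "openin (zariski (ideal_of_forms d ` \<V>)) U" "U \<noteq> {}"
    and T: "openin (zariski (ideal_of_forms d ` \<V>)) T" "T \<noteq> {}"
  shows "U \<inter> T \<noteq> {}"
proof -
  let ?X = "ideal_of_forms d ` \<V>"
  obtain V W where V: "V \<in> \<V>" "ideal_of_forms d V \<in> U" and W: "W \<in> \<V>" "ideal_of_forms d W \<in> T"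
  proof -
    have sub: "U \<subseteq> ?X" "T \<subseteq> ?X" using U(1) T(1) by (simp_all add: openin_zariski)
    obtain I J where "I \<in> U" "J \<in> T" using U(2) T(2) by blast
    then have "I \<in> ?X" "J \<in> ?X" using sub by (auto simp only: subsetD)
    then show ?thesis using \<open>I \<in> U\<close> \<open>J \<in> T\<close> that by (elim imageE) simp
  qed
  from line[unfolded line_connected_def Let_def, rule_format, OF V(1) W(1)]
  obtain v w where v: "V = kxy.span (v ` {..<s})" and w: "W = kxy.span (w ` {..<s})"
    and vw: "\<forall>l. independent_family s (\<lambda>j. scalar (1 - l) (v j) + scalar l (w j)) \<longrightarrow>
      kxy.span ((\<lambda>j. scalar (1 - l) (v j) + scalar l (w j)) ` {..<s}) \<in> \<V>"
    by (elim exE conjE)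
  define u where "u z j = scalar (1 - z ()) (v j) + scalar (z ()) (w j)" for z :: "unit \<Rightarrow> 'k" and j
  have u0: "u (\<lambda>_. 0) = v" and u1: "u (\<lambda>_. 1) = w" by (auto simp: u_def)
  have vin: "v j \<in> forms d" "w j \<in> forms d" if "j < s" for j
    using \<V>[OF V(1)] \<V>[OF W(1)] that unfolding v w by (auto intro: kxy.span_base)
  have iv: "independent_family s v" and iw: "independent_family s w"
    using \<V>[OF V(1)] \<V>[OF W(1)] unfolding v w independent_family_iff_dim by blast+
  have coords: "poly_fun (\<lambda>z. Poly_Mapping.lookup (u z j) m)" for j m
  proof -
    have "(\<lambda>z. Poly_Mapping.lookup (u z j) m) = (\<lambda>z. (1 + (-1) * z ()) * Poly_Mapping.lookup (v j) m
        + z () * Poly_Mapping.lookup (w j) m)"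
      by (simp add: u_def lookup_add)
    then show ?thesis by (simp only:) (intro poly_fun.intros)
  qed
  have frame: "poly_fun (\<lambda>z. F (frame_coords (standard_frame d s (u z))))" if "poly_fun F" for F
  proof (rule poly_fun_compose[OF that])
    fix x :: "nat \<times> nat \<times> nat \<times> nat"
    obtain i j m where x: "x = (i, j, m)" by (cases x)
    show "poly_fun (\<lambda>z. frame_coords (standard_frame d s (u z)) x)"
    proof (cases "i = d \<and> j < s")
      case True
      then show ?thesis by (simp add: x frame_coords_def standard_frame_def coords)
    next
      case False
      show ?thesis
        unfolding x frame_coords_def standard_frame_def prod.case if_not_P[OF False]
        by (rule poly_fun.const)
    qed
  qed
  \<comment> \<open>An open set is a union of nonvanishing loci of polynomials in the frame coordinates; it
    suffices to work with one of them around the given ideal.\<close>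
  have test: "\<exists>F. poly_fun F \<and> F (frame_coords (standard_frame d s v')) \<noteq> 0 \<and>
      (\<forall>V'\<in>\<V>. \<forall>u'. independent_family s u' \<and> V' = kxy.span (u' ` {..<s}) \<and>
        F (frame_coords (standard_frame d s u')) \<noteq> 0 \<longrightarrow> ideal_of_forms d V' \<in> O')"
    if O: "openin (zariski ?X) O'" and v': "independent_family s v'" "V' = kxy.span (v' ` {..<s})"
      "V' \<in> \<V>" "ideal_of_forms d V' \<in> O'" for O' v' V'
  proof -
    obtain S where S: "\<forall>F\<in>S. poly_fun F"
      "\<forall>I\<in>?X. \<forall>v. ideal_frame I v \<longrightarrow> (I \<notin> O' \<longleftrightarrow> (\<forall>F\<in>S. F (frame_coords v) = 0))"
      using O unfolding openin_zariski zariski_closed_diff_iff by blast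
    have fr: "ideal_frame (ideal_of_forms d V'') (standard_frame d s u')"
      if "V'' \<in> \<V>" "independent_family s u'" "V'' = kxy.span (u' ` {..<s})" for V'' u'
      using ideal_frame_standard_frame[OF that(2,3)] \<V>[OF that(1)] by blast
    obtain F where F: "F \<in> S" "F (frame_coords (standard_frame d s v')) \<noteq> 0"
      using S(2) fr[OF v'(3,1,2)] v'(3,4) by blast
    then show ?thesis using S fr by blast
  qed
  obtain F where F: "poly_fun F" "F (frame_coords (standard_frame d s v)) \<noteq> 0"
    "\<And>V' u'. V' \<in> \<V> \<Longrightarrow> independent_family s u' \<Longrightarrow> V' = kxy.span (u' ` {..<s}) \<Longrightarrow>
        F (frame_coords (standard_frame d s u')) \<noteq> 0 \<Longrightarrow> ideal_of_forms d V' \<in> U"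
    using test[OF U(1) iv v V] by (elim exE conjE) blast
  obtain G where G: "poly_fun G" "G (frame_coords (standard_frame d s w)) \<noteq> 0"
    "\<And>V' u'. V' \<in> \<V> \<Longrightarrow> independent_family s u' \<Longrightarrow> V' = kxy.span (u' ` {..<s}) \<Longrightarrow>
        G (frame_coords (standard_frame d s u')) \<noteq> 0 \<Longrightarrow> ideal_of_forms d V' \<in> T"
    using test[OF T(1) iw w W] by (elim exE conjE) blast
  obtain \<phi> where \<phi>: "form_det d s \<phi> v \<noteq> 0"
    using exists_form_det_nonzero[OF vin(1) iv] by blast
  \<comment> \<open>The third condition keeps the frame at the common parameter independent.\<close>
  let ?FF = "{\<lambda>z. F (frame_coords (standard_frame d s (u z))),
    \<lambda>z. G (frame_coords (standard_frame d s (u z))), \<lambda>z. form_det d s \<phi> (u z)}"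
  have "poly_fun (\<lambda>z. form_det d s \<phi> (u z))"
    unfolding form_det_def
    by (intro poly_fun_det poly_fun_sum poly_fun.mult poly_fun.const coords)
  then have pf: "poly_fun H" if "H \<in> ?FF" for H using that frame[OF F(1)] frame[OF G(1)] by blast
  have "\<exists>l. \<forall>H\<in>?FF. H (\<lambda>_. l) \<noteq> 0"
  proof (rule poly_fun_common_nonzero[OF inf _ pf])
    fix H assume "H \<in> ?FF"
    then have "H (\<lambda>_. 0) \<noteq> 0 \<or> H (\<lambda>_. 1) \<noteq> 0" using F(2) G(2) \<phi> u0 u1 by auto
    then show "\<exists>l. H (\<lambda>_. l) \<noteq> 0" by blast
  qed simp_all
  then obtain l where l: "F (frame_coords (standard_frame d s (u (\<lambda>_. l)))) \<noteq> 0"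
    "G (frame_coords (standard_frame d s (u (\<lambda>_. l)))) \<noteq> 0" "form_det d s \<phi> (u (\<lambda>_. l)) \<noteq> 0"
    by auto
  have "u (\<lambda>_. l) j \<in> forms d" if "j < s" for j
    unfolding u_def using vin[OF that]
    by (intro kxy.subspace_add kxy.subspace_scale subspace_forms)
  then have ind: "independent_family s (u (\<lambda>_. l))"
    using l(3) by (rule independent_family_of_form_det)
  then have "kxy.span (u (\<lambda>_. l) ` {..<s}) \<in> \<V>"
    using vw unfolding u_def by simp
  then show ?thesis using F(3)[OF _ ind refl l(1)] G(3)[OF _ ind refl l(2)] by blast
qed

text \<open>
  The dimension reaches the upper bound \<open>r\<close> exactly when one of the \<open>r\<close>-fold determinants of
  multiples of the frame by the variables does not vanish.
\<close>

lemma open_max_linear_multiples: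
  fixes \<V> :: "'k::field kxy set set"
  assumes \<V>: "\<And>V. V \<in> \<V> \<Longrightarrow> kxy.subspace V \<and> V \<subseteq> forms d \<and> kxy.dim V = s"
    and max: "\<And>V. V \<in> \<V> \<Longrightarrow> kxy.dim (linear_multiples V) \<le> r"
  shows "openin (zariski (ideal_of_forms d ` \<V>))
    (ideal_of_forms d ` {V \<in> \<V>. kxy.dim (linear_multiples V) = r})"
proof -
  let ?X = "ideal_of_forms d ` \<V>" and ?U = "ideal_of_forms d ` {V \<in> \<V>. kxy.dim (linear_multiples V) = r}"
  \<comment> \<open>All polynomials that vanish on the complement; it remains to find one that does not vanish at a
    given frame of the open set.\<close>
  let ?S = "{F. poly_fun F \<and> (\<forall>V\<in>\<V>. kxy.dim (linear_multiples V) \<noteq> r \<longrightarrow>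
    (\<forall>v. ideal_frame (ideal_of_forms d V) v \<longrightarrow> F (frame_coords v) = 0))}"
  have nonzero: "\<exists>F\<in>?S. F (frame_coords v) \<noteq> 0"
    if V: "V \<in> \<V>" "kxy.dim (linear_multiples V) = r" and v: "ideal_frame (ideal_of_forms d V) v" for V v
  proof -
    let ?G = "(*) X ` (v d ` {..<s}) \<union> (*) Y ` (v d ` {..<s})"
    have sp: "kxy.span (v d ` {..<s}) = V"
      using frame_of_ideal_of_forms(1)[OF _ _ _ v] \<V>[OF V(1)] by blast
    have lm: "kxy.span ?G = linear_multiples V"
      unfolding sp[symmetric] linear_multiples_span by (simp add: linear_multiples_def)
    have "kxy.dim ?G = r" using V(2) by (metis lm kxy.dim_span)
    then obtain B where B: "B \<subseteq> ?G" "kxy.independent B" "card B = r"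
      by (metis kxy.basis_exists)
    have "finite ?G" by simp
    then have "finite B" using B(1) by (rule rev_finite_subset)
    then obtain e where e: "bij_betw e {..<r} B"
      using B(3) ex_bij_betw_nat_finite[of B] by (auto simp: lessThan_atLeast0)
    \<comment> \<open>Each basis vector is a variable times a frame vector; the same choice of variables and
      indices then makes sense for every other frame.\<close>
    have "\<forall>i\<in>{..<r}. \<exists>x. snd x < s \<and> fst x \<in> {(1, 0), (0, 1)} \<and> e i = monomial_xy (fst x) * v d (snd x)"
    proof
      fix i assume "i \<in> {..<r}"
      then have "e i \<in> ?G" using e B(1) by (auto simp: bij_betw_def)
      then show "\<exists>x. snd x < s \<and> fst x \<in> {(1, 0), (0, 1)} \<and> e i = monomial_xy (fst x) * v d (snd x)"
      proof
        assume "e i \<in> (*) X ` (v d ` {..<s})"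
        then obtain k where "k < s" "e i = X * v d k" by auto
        then show ?thesis by (intro exI[of _ "((1, 0), k)"]) simp
      next
        assume "e i \<in> (*) Y ` (v d ` {..<s})"
        then obtain k where "k < s" "e i = Y * v d k" by auto
        then show ?thesis by (intro exI[of _ "((0, 1), k)"]) simp
      qed
    qed
    from bchoice[OF this] obtain x where x: "\<forall>i\<in>{..<r}. snd (x i) < s \<and> fst (x i) \<in> {(1, 0), (0, 1)} \<and>
        e i = monomial_xy (fst (x i)) * v d (snd (x i))" by blast
    define m where "m v' i = monomial_xy (fst (x i)) * v' d (snd (x i))"
      for v' :: "nat \<Rightarrow> nat \<Rightarrow> 'k kxy" and i
    have mem: "m v' i \<in> linear_multiples V'"
      if "V' \<in> \<V>" "ideal_frame (ideal_of_forms d V') v'" "i < r" for V' v' i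
    proof -
      have "kxy.span (v' d ` {..<s}) = V'"
        using frame_of_ideal_of_forms(1)[OF _ _ _ that(2)] \<V>[OF that(1)] by blast
      then have "v' d (snd (x i)) \<in> V'" using x that(3) by (auto intro: kxy.span_base)
      moreover have "fst (x i) \<in> {(1, 0), (0, 1)}" using x that(3) by blast
      ultimately have "m v' i \<in> (*) X ` V' \<union> (*) Y ` V'"
        unfolding m_def by (elim insertE) (simp_all only: image_eqI UnI1 UnI2 empty_iff)
      then show ?thesis unfolding linear_multiples_def by (rule kxy.span_base)
    qed
    have mforms: "m v' i \<in> forms (Suc d)"
      if "V' \<in> \<V>" "ideal_frame (ideal_of_forms d V') v'" "i < r" for V' v' i
      using mem[OF that] linear_multiples_subset_forms[of V' d] \<V>[OF that(1)] by blast
    have "m v i = e i" if "i \<in> {..<r}" for i using x that by (auto simp: m_def)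
    then have "inj_on (m v) {..<r} = inj_on e {..<r}" "m v ` {..<r} = e ` {..<r}"
      by (intro inj_on_cong image_cong refl; blast)+
    then have "independent_family r (m v)"
      using e B(2) by (simp add: independent_family_def bij_betw_def)
    then obtain \<phi> where \<phi>: "form_det (Suc d) r \<phi> (m v) \<noteq> 0"
      using exists_form_det_nonzero[of r "m v" "Suc d", OF mforms[OF V(1) v]] by blast
    \<comment> \<open>The determinant of the multiples, written in the coordinates of the frame.\<close>
    define F where "F z = det (mat r r (\<lambda>(j, i). \<Sum>b<Suc (Suc d). \<phi> j b *
      (if fst (fst (x i)) \<le> Suc d - b \<and> snd (fst (x i)) \<le> b
       then z (d, snd (x i), (Suc d - b - fst (fst (x i)), b - snd (fst (x i)))) else 0)))"
      for z :: "nat \<times> nat \<times> (nat \<times> nat) \<Rightarrow> 'k"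
    have F: "F (frame_coords v') = form_det (Suc d) r \<phi> (m v')" for v'
    proof -
      have "coeff_y (Suc d) (m v' i) b = (if fst (fst (x i)) \<le> Suc d - b \<and> snd (fst (x i)) \<le> b
       then frame_coords v' (d, snd (x i), (Suc d - b - fst (fst (x i)), b - snd (fst (x i)))) else 0)" for i b
        unfolding m_def frame_coords_def
        using lookup_monomial_mult[of "fst (fst (x i))" "snd (fst (x i))" "v' d (snd (x i))" "Suc d - b" b]
        by simp
      then show ?thesis unfolding F_def form_det_def by simp
    qed
    have "poly_fun (\<lambda>z. if P then z y else 0 :: 'k)" for P and y :: "nat \<times> nat \<times> (nat \<times> nat)"
      by (cases P) (auto intro: poly_fun.intros)
    then have "poly_fun F"
      unfolding F_def
      by (intro poly_fun_det poly_fun_sum poly_fun.mult poly_fun.const)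
    moreover have "F (frame_coords v') = 0"
      if V': "V' \<in> \<V>" "kxy.dim (linear_multiples V') \<noteq> r"
        and v': "ideal_frame (ideal_of_forms d V') v'" for V' v'
    proof (rule ccontr)
      assume "F (frame_coords v') \<noteq> 0"
      then have "independent_family r (m v')"
        unfolding F using independent_family_of_form_det[of r "m v'" "Suc d", OF mforms[OF V'(1) v']] by blast
      moreover have "linear_multiples V' \<subseteq> forms (Suc d)"
        using linear_multiples_subset_forms \<V>[OF V'(1)] by blast
      then have "linear_multiples V' \<subseteq> kxy.span (form_monomial (Suc d) ` {..<Suc (Suc d)})"
        using forms_finite(2) by (rule order_trans)
      ultimately have "r \<le> kxy.dim (linear_multiples V')"
        using kxy.independent_card_le_dim_of_finite[OF forms_finite(1)[of "Suc d"],
            of "linear_multiples V'" "m v' ` {..<r}"] mem[OF V'(1) v']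
        by (auto simp: independent_family_def card_image)
      then show False using max[OF V'(1)] V'(2) by simp
    qed
    ultimately show ?thesis using \<phi> F by (intro bexI[of _ F]) auto
  qed
  show ?thesis
    unfolding openin_zariski zariski_closed_diff_iff
  proof (intro conjI exI[of _ ?S] ballI allI impI)
    fix I v assume I: "I \<in> ?X" "ideal_frame I v"
    then obtain V where V: "V \<in> \<V>" "I = ideal_of_forms d V" by blast
    show "I \<notin> ?U \<longleftrightarrow> (\<forall>F\<in>?S. F (frame_coords v) = 0)"
    proof
      assume "I \<notin> ?U"
      then have "kxy.dim (linear_multiples V) \<noteq> r" using V by blast
      then show "\<forall>F\<in>?S. F (frame_coords v) = 0" using V I(2) by blast
    next
      assume "\<forall>F\<in>?S. F (frame_coords v) = 0"
      then have "kxy.dim (linear_multiples W) \<noteq> r" if "W \<in> \<V>" "I = ideal_of_forms d W" for W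
        using nonzero[OF that(1)] that(2) I(2) by blast
      then show "I \<notin> ?U" by blast
    qed
  qed auto
qed

lemma generic_min_gens:
  fixes \<V> :: "'k::field kxy set set"
  assumes inf: "infinite (UNIV :: 'k set)"
    and \<V>: "\<And>V. V \<in> \<V> \<Longrightarrow> kxy.subspace V \<and> V \<subseteq> forms d \<and> kxy.dim V = s"
    and line: "line_connected s \<V>"
    and max: "\<And>V. V \<in> \<V> \<Longrightarrow> kxy.dim (linear_multiples V) \<le> r"
    and attained: "V\<^sub>0 \<in> \<V>" "kxy.dim (linear_multiples V\<^sub>0) = r"
  shows "generic_value (ideal_of_forms d ` \<V>) min_gens = s + d + 2 - r"
proof (rule generic_value_eq)
  let ?X = "ideal_of_forms d ` \<V>" and ?U = "ideal_of_forms d ` {V \<in> \<V>. kxy.dim (linear_multiples V) = r}"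
  have op: "openin (zariski ?X) ?U"
    using \<V> max by (rule open_max_linear_multiples)
  have ne: "?U \<noteq> {}" using attained by blast
  have "I \<in> zariski ?X closure_of ?U" if I: "I \<in> ?X" for I
    unfolding in_closure_of
  proof (intro conjI allI impI)
    show "I \<in> topspace (zariski ?X)" using I by simp
    fix T assume "I \<in> T \<and> openin (zariski ?X) T"
    then have "?U \<inter> T \<noteq> {}" using \<V> by (intro open_sets_meet[OF inf _ line op ne]) blast+
    then show "\<exists>J. J \<in> ?U \<and> J \<in> T" by blast
  qed
  then have dense: "zariski ?X closure_of ?U = ?X"
    using closure_of_subset_topspace[of "zariski ?X" ?U] by auto
  have "min_gens I = s + d + 2 - r" if "I \<in> ?U" for I
  proof -
    from \<open>I \<in> ?U\<close> obtain V
      where V: "V \<in> \<V>" "kxy.dim (linear_multiples V) = r" "I = ideal_of_forms d V"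
      by blast
    then show ?thesis using min_gens_ideal_of_forms[of V d] \<V>[OF V(1)] by simp
  qed
  then show "generic_on ?X min_gens (s + d + 2 - r)"
    unfolding generic_on_def using op ne dense by blast
qed

section \<open>Initial ideals and Jordan cells\<close>

lemma initial_monomial_form:
  assumes f: "f \<in> forms n" "f \<noteq> 0"
  shows "\<exists>b\<le>n. initial_monomial f = (n - b, b) \<and> f \<in> low_forms n (Suc b) \<and> coeff_y n f b \<noteq> 0"
proof -
  obtain k where k: "k \<in> Poly_Mapping.keys f"
    using f(2) by (metis in_keys_iff lookup_zero poly_mapping_eqI)
  have bound: "\<forall>y. y \<in> Poly_Mapping.keys f \<longrightarrow> snd y < Suc n"
    using f(1) by (auto simp: forms_def)
  have "initial_monomial f \<in> Poly_Mapping.keys f \<and>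
      (\<forall>y. y \<in> Poly_Mapping.keys f \<longrightarrow> snd y \<le> snd (initial_monomial f))"
    unfolding initial_monomial_def arg_max_on_def by (rule arg_max_nat_lemma[OF k bound])
  moreover obtain a b where ab: "initial_monomial f = (a, b)" by (cases "initial_monomial f")
  ultimately have key: "Poly_Mapping.lookup f (a, b) \<noteq> 0"
    and le: "\<And>a' b'. Poly_Mapping.lookup f (a', b') \<noteq> 0 \<Longrightarrow> b' \<le> b"
    by (auto simp: in_keys_iff)
  have "a + b = n" using f(1) key by (auto simp: forms_iff)
  moreover have "f \<in> low_forms n (Suc b)"
    using f(1) le by (auto simp: low_forms_def forms_iff less_Suc_eq_le)
  ultimately show ?thesis using ab key by (intro exI[of _ b]) auto
qed

lemma initial_monomial_eq:
  assumes f: "f \<in> low_forms n (Suc b)" "coeff_y n f b \<noteq> 0"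
  shows "initial_monomial f = (n - b, b)"
proof -
  have "f \<in> forms n" using f(1) low_forms_subset_forms by blast
  moreover have "f \<noteq> 0" using f(2) by auto
  ultimately obtain c where c: "initial_monomial f = (n - c, c)" "f \<in> low_forms n (Suc c)"
    "coeff_y n f c \<noteq> 0" using initial_monomial_form by blast
  have "b1 < Suc b2" if "f \<in> low_forms n (Suc b2)" "coeff_y n f b1 \<noteq> 0" for b1 b2
    using that unfolding low_forms_def by blast
  then have "c \<le> b" "b \<le> c" using f c(2,3) less_Suc_eq_le by blast+
  then show ?thesis using c(1) by simp
qed

lemma leads_empty:
  assumes "kxy.subspace V" "V \<subseteq> forms n" "leads n V = {}"
  shows "V = {0}"
proof -
  have "f = 0" if "f \<in> V" for f
  proof (rule ccontr)
    assume "f \<noteq> 0"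
    moreover have "f \<in> forms n" using that assms(2) by (rule subsetD[rotated])
    ultimately obtain b where "b \<le> n" "f \<in> low_forms n (Suc b)" "coeff_y n f b \<noteq> 0"
      using initial_monomial_form by blast
    then have "b \<in> leads n V" using that by (auto simp: leads_def)
    then show False using assms(3) by simp
  qed
  then show ?thesis using kxy.subspace_0[OF assms(1)] by blast
qed

lemma leads_full:
  assumes "kxy.subspace V" "V \<subseteq> forms n" "leads n V = {..n}"
  shows "V = forms n"
proof (rule kxy.subspace_eq_of_dim_ge[OF forms_finite(1,2) assms(2,1)])
  show "kxy.dim (forms n :: 'a kxy set) \<le> kxy.dim V"
    using dim_eq_card_leads[OF assms(1,2)] assms(3) by (simp add: dim_forms)
qed

definition monomial_up_closed :: "(nat \<times> nat) set \<Rightarrow> bool" where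
  "monomial_up_closed A \<longleftrightarrow> (\<forall>a b p q. (a, b) \<in> A \<longrightarrow> (p + a, q + b) \<in> A)"

lemma monomial_ideal_eq:
  assumes A: "monomial_up_closed A"
  shows "ideal.span (monomial_xy ` A) = {f. Poly_Mapping.keys f \<subseteq> A}"
proof
  let ?M = "{f :: 'a kxy. Poly_Mapping.keys f \<subseteq> A}"
  show "ideal.span (monomial_xy ` A) \<subseteq> ?M"
  proof (rule ideal.span_minimal)
    show "monomial_xy ` A \<subseteq> ?M" by (auto simp: monomial_xy_def)
    show "ideal.subspace ?M"
    proof (rule ideal_subspaceI)
      show "kxy.subspace ?M"
        unfolding kxy.subspace_def
        by (auto simp: in_keys_iff lookup_add subset_iff) (metis add.right_neutral)
    next
      fix p q and f :: "'a kxy" assume f: "f \<in> ?M"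
      have "(a, b) \<in> A" if "Poly_Mapping.lookup (monomial_xy (p, q) * f) (a, b) \<noteq> 0" for a b
      proof -
        have le: "p \<le> a" "q \<le> b" and nz: "Poly_Mapping.lookup f (a - p, b - q) \<noteq> 0"
          using that by (auto simp: lookup_monomial_mult split: if_splits)
        have "(a - p, b - q) \<in> A" using f nz by (auto simp: in_keys_iff)
        then have "(p + (a - p), q + (b - q)) \<in> A"
          using A unfolding monomial_up_closed_def by blast
        then show ?thesis using le by simp
      qed
      then show "monomial_xy (p, q) * f \<in> ?M" by (auto simp: in_keys_iff)
    qed
  qed
  show "?M \<subseteq> ideal.span (monomial_xy ` A)"
  proof
    fix f assume f: "f \<in> ?M"
    have "(\<Sum>m\<in>Poly_Mapping.keys f. scalar (Poly_Mapping.lookup f m) (monomial_xy m))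
        \<in> ideal.span (monomial_xy ` A)"
      using f by (intro ideal.span_sum ideal_span_scalar ideal.span_base) auto
    then show "f \<in> ideal.span (monomial_xy ` A)" by (simp only: kxy_expansion[symmetric])
  qed
qed

lemma monomial_ideal_inj:
  assumes "monomial_up_closed A" "monomial_up_closed B"
  shows "ideal.span (monomial_xy ` A :: 'k::field kxy set) = ideal.span (monomial_xy ` B) \<longleftrightarrow> A = B"
proof
  assume eq: "ideal.span (monomial_xy ` A :: 'k kxy set) = ideal.span (monomial_xy ` B)"
  have "m \<in> A \<longleftrightarrow> m \<in> B" for m
  proof -
    have "m \<in> A \<longleftrightarrow> (monomial_xy m :: 'k kxy) \<in> ideal.span (monomial_xy ` A)"
      unfolding monomial_ideal_eq[OF assms(1)] by (simp add: monomial_xy_def)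
    also have "\<dots> \<longleftrightarrow> m \<in> B"
      unfolding eq unfolding monomial_ideal_eq[OF assms(2)] by (simp add: monomial_xy_def)
    finally show ?thesis .
  qed
  then show "A = B" by blast
qed simp

lemma leads_monomial_ideal:
  "leads n ({f :: 'k::field kxy. Poly_Mapping.keys f \<subseteq> A} \<inter> forms n) = {b. b \<le> n \<and> (n - b, b) \<in> A}"
proof (intro Set.set_eqI iffI)
  fix b assume "b \<in> leads n ({f :: 'k kxy. Poly_Mapping.keys f \<subseteq> A} \<inter> forms n)"
  then show "b \<in> {b. b \<le> n \<and> (n - b, b) \<in> A}"
    by (auto simp: leads_def in_keys_iff subset_iff)
next
  fix b assume b: "b \<in> {b. b \<le> n \<and> (n - b, b) \<in> A}"
  have "(form_monomial n b :: 'k kxy) \<in> {f. Poly_Mapping.keys f \<subseteq> A} \<inter> forms n"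
    using b form_monomial_mem[of b "Suc n" n]
    by (auto simp: form_monomial_def monomial_xy_def forms_eq_low_forms)
  moreover have "(form_monomial n b :: 'k kxy) \<in> low_forms n (Suc b)"
    using b by (intro form_monomial_mem) auto
  moreover have "coeff_y n (form_monomial n b :: 'k kxy) b \<noteq> 0" by (simp add: lookup_form_monomial)
  ultimately show "b \<in> leads n ({f :: 'k kxy. Poly_Mapping.keys f \<subseteq> A} \<inter> forms n)"
    using b unfolding leads_def by blast
qed

definition initial_exponents :: "'k::field kxy set \<Rightarrow> (nat \<times> nat) set" where
  "initial_exponents I = {(a, b). b \<in> leads (a + b) (I \<inter> forms (a + b))}"

lemma initial_monomials_eq:
  "{initial_monomial f |f i. f \<in> I \<inter> forms i \<and> f \<noteq> 0} = initial_exponents I"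
proof (intro equalityI subsetI)
  fix m assume "m \<in> {initial_monomial f |f i. f \<in> I \<inter> forms i \<and> f \<noteq> 0}"
  then obtain f i where f: "m = initial_monomial f" "f \<in> I" "f \<in> forms i" "f \<noteq> 0" by blast
  obtain b where "b \<le> i" "m = (i - b, b)" "f \<in> low_forms i (Suc b)" "coeff_y i f b \<noteq> 0"
    using initial_monomial_form[OF f(3,4)] f(1) by blast
  then show "m \<in> initial_exponents I"
    using f(2,3) by (auto simp: initial_exponents_def leads_def)
next
  fix m assume m: "m \<in> initial_exponents I"
  obtain a b where ab: "m = (a, b)" by (cases m)
  obtain f where f: "f \<in> I \<inter> forms (a + b)" "f \<in> low_forms (a + b) (Suc b)" "coeff_y (a + b) f b \<noteq> 0"
    using m unfolding ab initial_exponents_def leads_def by blast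
  have "initial_monomial f = m" using initial_monomial_eq[OF f(2,3)] by (simp add: ab)
  moreover have "f \<noteq> 0" using f(3) by auto
  ultimately show "m \<in> {initial_monomial f |f i. f \<in> I \<inter> forms i \<and> f \<noteq> 0}"
    using f(1) by blast
qed

lemma monomial_up_closed_initial_exponents:
  assumes I: "ideal.subspace I"
  shows "monomial_up_closed (initial_exponents I)"
  unfolding monomial_up_closed_def
proof (intro allI impI)
  fix a b p q assume "(a, b) \<in> initial_exponents I"
  then obtain f where f: "f \<in> I" "f \<in> low_forms (a + b) (Suc b)" "coeff_y (a + b) f b \<noteq> 0"
    unfolding initial_exponents_def leads_def by blast
  let ?g = "monomial_xy (p, q) * f" and ?n = "p + a + (q + b)"
  have g: "?g \<in> low_forms ?n (Suc (q + b))"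
    unfolding low_forms_def
  proof (intro CollectI allI impI)
    fix a' b' assume "Poly_Mapping.lookup ?g (a', b') \<noteq> 0"
    then have "p \<le> a'" "q \<le> b'" "Poly_Mapping.lookup f (a' - p, b' - q) \<noteq> 0"
      by (auto simp: lookup_monomial_mult split: if_splits)
    then have "a' - p + (b' - q) = a + b \<and> b' - q < Suc b" using f(2) by (simp add: low_forms_def)
    then show "a' + b' = ?n \<and> b' < Suc (q + b)" using \<open>p \<le> a'\<close> \<open>q \<le> b'\<close> by linarith
  qed
  moreover have "?g \<in> I" using ideal.subspace_scale[OF I f(1)] .
  moreover have "?g \<in> forms ?n" using g low_forms_subset_forms by blast
  moreover have "coeff_y ?n ?g (q + b) \<noteq> 0" using f(3) by (simp add: lookup_monomial_mult)
  ultimately show "(p + a, q + b) \<in> initial_exponents I"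
    unfolding initial_exponents_def leads_def by auto
qed

lemma monomial_up_closed_compl_C_mon:
  assumes "is_partition P"
  shows "monomial_up_closed (- C_mon P)"
  unfolding monomial_up_closed_def
proof (intro allI impI)
  fix a b p q assume ab: "(a, b) \<in> - C_mon P"
  have "P ! (q + b) \<le> P ! b" if "q + b < length P"
    using assms that sorted_wrt_nth_less[of "(\<ge>)" P b "q + b"]
    by (cases "q = 0") (auto simp: is_partition_def)
  then show "(p + a, q + b) \<in> - C_mon P" using ab by (fastforce simp: C_mon_def)
qed

lemma jordan_cell_iff:
  assumes P: "is_partition P"
  shows "I \<in> jordan_cell P \<longleftrightarrow> graded_ideal I \<and> initial_exponents I = - C_mon P"
proof -
  have "initial_ideal I = E_ideal P \<longleftrightarrow> initial_exponents I = - C_mon P" if "graded_ideal I"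
  proof -
    have "initial_ideal I = ideal.span (monomial_xy ` initial_exponents I)"
      unfolding initial_ideal_def initial_monomials_eq[symmetric]
      by (rule arg_cong[where f = ideal.span]) blast
    then show ?thesis
      unfolding E_ideal_def
      using monomial_ideal_inj[OF monomial_up_closed_initial_exponents monomial_up_closed_compl_C_mon[OF P]]
        graded_ideal_subspace[OF that] by simp
  qed
  then show ?thesis unfolding jordan_cell_def by blast
qed

lemma card_atMost_split: "card {b. b \<le> n \<and> \<not> Q b} + card {b. b \<le> n \<and> Q b} = Suc (n :: nat)"
proof -
  have "{..n} = {b. b \<le> n \<and> \<not> Q b} \<union> {b. b \<le> n \<and> Q b}" by auto
  then have "card {..n} = card {b. b \<le> n \<and> \<not> Q b} + card {b. b \<le> n \<and> Q b}"
    by (simp only:) (intro card_Un_disjoint; auto)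
  then show ?thesis by simp
qed

lemma diagonal_lengths_eq:
  fixes K :: "'k::field itself"
  assumes P: "is_partition P"
  shows "diagonal_lengths K P n = card {b. b \<le> n \<and> (n - b, b) \<in> C_mon P}"
proof -
  let ?E = "{f :: 'k kxy. Poly_Mapping.keys f \<subseteq> - C_mon P}"
  have E: "E_ideal P = ?E"
    unfolding E_ideal_def by (rule monomial_ideal_eq[OF monomial_up_closed_compl_C_mon[OF P]])
  have "kxy.subspace (E_ideal P :: 'k kxy set)"
    unfolding E_ideal_def by (rule subspace_ideal_span)
  then have "kxy.subspace (?E \<inter> forms n)" unfolding E by (intro kxy.subspace_inter subspace_forms)
  then have "kxy.dim (?E \<inter> forms n) = card {b. b \<le> n \<and> (n - b, b) \<in> - C_mon P}"
    by (subst dim_eq_card_leads[of _ n]) (auto simp: leads_monomial_ideal)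
  then show ?thesis
    using card_atMost_split[of n "\<lambda>b. (n - b, b) \<in> C_mon P"]
    by (simp add: diagonal_lengths_def hilbert_quot_def E dim_forms)
qed

definition E_exponents :: "nat \<Rightarrow> nat list \<Rightarrow> nat set" where
  "E_exponents d P = {b. b \<le> d \<and> (d - b, b) \<notin> C_mon P}"

text \<open>
  The monomials outside of a monomial ideal that starts in degree \<open>d\<close> with the \<open>y\<close>-exponents \<open>S\<close>
  and contains everything of higher degree.
\<close>

definition staircase :: "nat \<Rightarrow> nat set \<Rightarrow> (nat \<times> nat) set" where
  "staircase d S = {(a, b). a + b < d \<or> a + b = d \<and> b \<notin> S}"

lemma partitions_of_diag_iff:
  fixes K :: "'k::field itself"
  assumes t: "t \<le> d" and T: "T = (\<lambda>i. if i < d then i + 1 else if i = d then t else 0)"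
  shows "P \<in> partitions_of_diag K T \<longleftrightarrow>
    is_partition P \<and> C_mon P = staircase d (E_exponents d P) \<and> card (E_exponents d P) = Suc d - t"
proof (cases "is_partition P")
  case True
  let ?c = "\<lambda>n. {b. b \<le> n \<and> (n - b, b) \<in> C_mon P}"
  have fin: "finite (?c n)" for n by simp
  have mc: "card (E_exponents d P) + card (?c d) = Suc d"
    unfolding E_exponents_def by (rule card_atMost_split)
  have "P \<in> partitions_of_diag K T \<longleftrightarrow> (\<forall>n. card (?c n) = T n)"
    using True by (auto simp: partitions_of_diag_def fun_eq_iff diagonal_lengths_eq[OF True])
  also have "\<dots> \<longleftrightarrow> (\<forall>n<d. ?c n = {..n}) \<and> (\<forall>n>d. ?c n = {}) \<and> card (?c d) = t"
  proof -
    have "card (?c n) = n + 1 \<longleftrightarrow> ?c n = {..n}" for n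
    proof
      assume "card (?c n) = n + 1"
      then show "?c n = {..n}" by (intro card_seteq) auto
    qed simp
    moreover have "card (?c n) = 0 \<longleftrightarrow> ?c n = {}" for n using fin by (simp only: card_0_eq)
    moreover have "(\<forall>n. card (?c n) = T n) \<longleftrightarrow>
        (\<forall>n<d. card (?c n) = n + 1) \<and> (\<forall>n>d. card (?c n) = 0) \<and> card (?c d) = t"
    proof
      assume A: "\<forall>n. card (?c n) = T n"
      have "card (?c n) = T n" for n using A by (rule spec)
      then show "(\<forall>n<d. card (?c n) = n + 1) \<and> (\<forall>n>d. card (?c n) = 0) \<and> card (?c d) = t"
        unfolding T by simp
    next
      assume A: "(\<forall>n<d. card (?c n) = n + 1) \<and> (\<forall>n>d. card (?c n) = 0) \<and> card (?c d) = t"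
      show "\<forall>n. card (?c n) = T n"
      proof
        fix n
        show "card (?c n) = T n" unfolding T using A by (cases n d rule: linorder_cases) simp_all
      qed
    qed
    ultimately show ?thesis by (simp only:)
  qed
  also have "\<dots> \<longleftrightarrow> C_mon P = staircase d (E_exponents d P) \<and> card (E_exponents d P) = Suc d - t"
  proof -
    have "(\<forall>n<d. ?c n = {..n}) \<and> (\<forall>n>d. ?c n = {}) \<longleftrightarrow> C_mon P = staircase d (E_exponents d P)"
    proof
      assume A: "(\<forall>n<d. ?c n = {..n}) \<and> (\<forall>n>d. ?c n = {})"
      have "(a, b) \<in> C_mon P \<longleftrightarrow> (a, b) \<in> staircase d (E_exponents d P)" for a b
      proof (cases "a + b" d rule: linorder_cases)
        case less
        then have "b \<in> ?c (a + b)" using A by auto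
        then show ?thesis using less by (simp add: staircase_def)
      next
        case equal
        then show ?thesis by (auto simp: staircase_def E_exponents_def)
      next
        case greater
        then have none: "?c (a + b) = {}" using A by blast
        have "b \<notin> ?c (a + b)" unfolding none by simp
        then show ?thesis using greater by (simp add: staircase_def)
      qed
      then show "C_mon P = staircase d (E_exponents d P)" by auto
    next
      assume C: "C_mon P = staircase d (E_exponents d P)"
      show "(\<forall>n<d. ?c n = {..n}) \<and> (\<forall>n>d. ?c n = {})"
        unfolding C by (auto simp: staircase_def)
    qed
    moreover have "card (?c d) = t \<longleftrightarrow> card (E_exponents d P) = Suc d - t"
      using mc t by auto
    ultimately show ?thesis by blast
  qed
  finally show ?thesis using True by blast
qed (auto simp: partitions_of_diag_def)

text \<open>
  The initial monomials of an ideal in the cell leave no freedom outside of degree \<open>d\<close>: by dimension,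
  they force it to vanish below and to contain all forms above.
\<close>

lemma jordan_cell_eq:
  assumes P: "is_partition P" and C: "C_mon P = staircase d (E_exponents d P)"
  shows "jordan_cell P = ideal_of_forms d `
    {V :: 'k::field kxy set. kxy.subspace V \<and> V \<subseteq> forms d \<and> leads d V = E_exponents d P}"
proof (intro equalityI subsetI)
  fix I :: "'k kxy set" assume "I \<in> jordan_cell P"
  then have I: "graded_ideal I" "initial_exponents I = - C_mon P"
    by (simp_all add: jordan_cell_iff[OF P])
  have sub: "kxy.subspace (I \<inter> forms n)" for n
    by (intro kxy.subspace_inter subspace_forms ideal_kxy_subspace graded_ideal_subspace I)
  have leads: "b \<in> leads n (I \<inter> forms n) \<longleftrightarrow> b \<le> n \<and> (n - b, b) \<notin> staircase d (E_exponents d P)" for n b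
  proof (cases "b \<le> n")
    case True
    then have "b \<in> leads n (I \<inter> forms n) \<longleftrightarrow> (n - b, b) \<in> initial_exponents I"
      by (simp add: initial_exponents_def)
    then show ?thesis using True by (simp add: I(2) C)
  next
    case False
    then show ?thesis using leads_subset[of n "I \<inter> forms n"] by auto
  qed
  have "I = ideal_of_forms d (I \<inter> forms d)"
  proof (rule graded_ideal_eq_ideal_of_forms[OF I(1)])
    fix n
    show "I \<inter> forms n = {0}" if "n < d"
      using that by (intro leads_empty[OF sub, of n]) (auto simp: leads staircase_def)
    show "forms n \<subseteq> I" if "d < n"
    proof -
      have "leads n (I \<inter> forms n) = {..n}" using that by (auto simp: leads staircase_def)
      then have "I \<inter> forms n = forms n" by (intro leads_full[OF sub]) auto
      then show ?thesis by blast
    qed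
  qed
  moreover have "leads d (I \<inter> forms d) = E_exponents d P"
    by (auto simp: leads staircase_def E_exponents_def)
  ultimately show "I \<in> ideal_of_forms d `
      {V. kxy.subspace V \<and> V \<subseteq> forms d \<and> leads d V = E_exponents d P}"
    using sub[of d] by (intro image_eqI[of _ _ "I \<inter> forms d"]) auto
next
  fix I :: "'k kxy set"
  assume "I \<in> ideal_of_forms d ` {V. kxy.subspace V \<and> V \<subseteq> forms d \<and> leads d V = E_exponents d P}"
  then obtain V where V: "kxy.subspace V" "V \<subseteq> forms d" "leads d V = E_exponents d P"
    and I: "I = ideal_of_forms d V" by blast
  have full: "leads n (forms n :: 'k kxy set) = {..<Suc n}" for n
    unfolding forms_eq_low_forms by (rule leads_low_forms) simp
  have zero: "leads n {0 :: 'k kxy} = {}" for n by (auto simp: leads_def)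
  have "(a, b) \<in> initial_exponents I \<longleftrightarrow> (a, b) \<notin> staircase d (E_exponents d P)" for a b
  proof (cases "a + b" d rule: linorder_cases)
    case less
    then show ?thesis
      by (simp add: initial_exponents_def I ideal_of_forms_Int_forms[OF V(1,2)] zero staircase_def)
  next
    case equal
    then show ?thesis
      by (simp add: initial_exponents_def I ideal_of_forms_Int_forms[OF V(1,2)] V(3) staircase_def)
  next
    case greater
    then show ?thesis
      by (simp add: initial_exponents_def I ideal_of_forms_Int_forms[OF V(1,2)] full staircase_def
          del: lessThan_Suc)
  qed
  then have "initial_exponents I = - C_mon P" unfolding C by auto
  then show "I \<in> jordan_cell P"
    unfolding jordan_cell_iff[OF P] using graded_ideal_ideal_of_forms[OF V(1,2)] I by simp
qed

lemma G_var_eq: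
  assumes t: "t \<le> d" and T: "T = (\<lambda>i. if i < d then i + 1 else if i = d then t else 0)"
  shows "G_var T = ideal_of_forms d `
    {V :: 'k::field kxy set. kxy.subspace V \<and> V \<subseteq> forms d \<and> kxy.dim V = Suc d - t}"
proof (intro equalityI subsetI)
  fix I :: "'k kxy set" assume "I \<in> G_var T"
  then have I: "graded_ideal I" and hq: "hilbert_quot I n = T n" for n by (auto simp: G_var_def)
  have h: "Suc n - kxy.dim (I \<inter> forms n) = T n" for n
    using hq[of n] by (simp add: hilbert_quot_def dim_forms)
  have sub: "kxy.subspace (I \<inter> forms n)" for n
    by (intro kxy.subspace_inter subspace_forms ideal_kxy_subspace graded_ideal_subspace I)
  have dim: "kxy.dim (I \<inter> forms n) = card (leads n (I \<inter> forms n))" for n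
    using sub by (rule dim_eq_card_leads) simp
  have fin: "finite (leads n (I \<inter> forms n))" for n by (rule finite_subset[OF leads_subset]) simp
  have "I = ideal_of_forms d (I \<inter> forms d)"
  proof (rule graded_ideal_eq_ideal_of_forms[OF I(1)])
    fix n
    show "I \<inter> forms n = {0}" if "n < d"
    proof (rule leads_empty[OF sub])
      have "card (leads n (I \<inter> forms n)) = 0" using h[of n] that unfolding dim T by auto
      then show "leads n (I \<inter> forms n) = {}" using fin by simp
    qed simp
    show "forms n \<subseteq> I" if "d < n"
    proof -
      have "card {..n} \<le> card (leads n (I \<inter> forms n))" using h[of n] that unfolding dim T by auto
      then have "leads n (I \<inter> forms n) = {..n}" by (intro card_seteq leads_subset) simp_all
      then have "I \<inter> forms n = forms n" by (intro leads_full[OF sub]) auto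
      then show ?thesis by blast
    qed
  qed
  moreover have "kxy.dim (I \<inter> forms d) = Suc d - t"
  proof -
    have "kxy.dim (I \<inter> forms d) \<le> Suc d"
      using kxy.dim_subset_of_finite[OF forms_finite, of "I \<inter> forms d"] by (simp add: dim_forms)
    then show ?thesis using h[of d] t unfolding T by simp
  qed
  ultimately show "I \<in> ideal_of_forms d `
      {V. kxy.subspace V \<and> V \<subseteq> forms d \<and> kxy.dim V = Suc d - t}"
    using sub[of d] by (intro image_eqI[of _ _ "I \<inter> forms d"]) auto
next
  fix I :: "'k kxy set"
  assume "I \<in> ideal_of_forms d ` {V. kxy.subspace V \<and> V \<subseteq> forms d \<and> kxy.dim V = Suc d - t}"
  then obtain V where V: "kxy.subspace V" "V \<subseteq> forms d" "kxy.dim V = Suc d - t"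
    and I: "I = ideal_of_forms d V" by blast
  have "kxy.dim {0 :: 'k kxy} = 0"
    using kxy.dim_le_card[of "{0}" "{}"] by simp
  then have "hilbert_quot I n = T n" for n
    using t by (simp add: hilbert_quot_def dim_forms I ideal_of_forms_Int_forms[OF V(1,2)] V(3) T)
  then show "I \<in> G_var T"
    unfolding G_var_def using graded_ideal_ideal_of_forms[OF V(1,2)] I by auto
qed

section \<open>The generic number of generators\<close>

text \<open>
  The dimension of the span is at most the number \<open>s\<close> of vectors, and it is the number of leading
  exponents; so there are no others than those of the vectors themselves.
\<close>

lemma leads_span_echelon:
  fixes s d :: nat
  assumes e: "bij_betw e {..<s} S" and S: "S \<subseteq> {..d}"
    and u: "\<And>j. j < s \<Longrightarrow> u j \<in> low_forms d (Suc (e j)) \<and> coeff_y d (u j) (e j) \<noteq> 0"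
  shows "leads d (kxy.span (u ` {..<s})) = S"
proof -
  let ?V = "kxy.span (u ` {..<s})"
  have cardS: "card S = s" using bij_betw_same_card[OF e] by simp
  have "u j \<in> forms d" if "j < s" for j
    using u[OF that] low_forms_subset_forms by blast
  then have V: "?V \<subseteq> forms d" by (intro kxy.span_minimal[OF _ subspace_forms]) auto
  have "S \<subseteq> leads d ?V"
  proof
    fix b assume b: "b \<in> S"
    then obtain j where j: "j < s" "b = e j" using e by (auto simp: bij_betw_def)
    have "u j \<in> ?V" using j(1) by (intro kxy.span_base) simp
    then show "b \<in> leads d ?V" using u[OF j(1)] b S j(2) unfolding leads_def by auto
  qed
  moreover have "card (leads d ?V) \<le> card S"
  proof -
    have "card (leads d ?V) = kxy.dim ?V" using dim_eq_card_leads[OF _ V] by simp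
    also have "\<dots> \<le> card (u ` {..<s})" by (rule kxy.dim_le_card) simp_all
    also have "\<dots> \<le> s" using card_image_le[of "{..<s}" u] by simp
    finally show ?thesis using cardS by simp
  qed
  moreover have "finite (leads d ?V)" by (rule finite_subset[OF leads_subset]) simp
  ultimately show ?thesis by (metis card_seteq)
qed

lemma exists_echelon_basis:
  fixes s d :: nat
  assumes V: "kxy.subspace V" "V \<subseteq> forms d" and e: "bij_betw e {..<s} (leads d V)"
  shows "\<exists>v. V = kxy.span (v ` {..<s}) \<and>
    (\<forall>j<s. v j \<in> low_forms d (Suc (e j)) \<and> coeff_y d (v j) (e j) = 1)"
proof -
  have "\<forall>j\<in>{..<s}. \<exists>f. f \<in> V \<and> f \<in> low_forms d (Suc (e j)) \<and> coeff_y d f (e j) = 1"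
  proof
    fix j assume "j \<in> {..<s}"
    then have "e j \<in> leads d V" using e by (auto simp: bij_betw_def)
    then obtain f where f: "f \<in> V" "f \<in> low_forms d (Suc (e j))" "coeff_y d f (e j) \<noteq> 0"
      unfolding leads_def by blast
    let ?g = "scalar (inverse (coeff_y d f (e j))) f"
    have "?g \<in> V" "?g \<in> low_forms d (Suc (e j))"
      using f(1,2) by (auto intro: kxy.subspace_scale[OF V(1)] kxy.subspace_scale[OF subspace_low_forms])
    moreover have "coeff_y d ?g (e j) = 1" using f(3) by simp
    ultimately show "\<exists>f. f \<in> V \<and> f \<in> low_forms d (Suc (e j)) \<and> coeff_y d f (e j) = 1" by blast
  qed
  from bchoice[OF this] obtain v where v: "\<forall>j\<in>{..<s}. v j \<in> V \<and> v j \<in> low_forms d (Suc (e j)) \<and>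
      coeff_y d (v j) (e j) = 1" by (elim exE)
  have sub: "kxy.span (v ` {..<s}) \<subseteq> V" using v by (intro kxy.span_minimal[OF _ V(1)]) auto
  have leads: "leads d (kxy.span (v ` {..<s})) = leads d V"
    using v by (intro leads_span_echelon[OF e leads_subset]) auto
  have "kxy.dim V \<le> kxy.dim (kxy.span (v ` {..<s}))"
    using dim_eq_card_leads[OF V] dim_eq_card_leads[OF kxy.subspace_span order_trans[OF sub V(2)]] leads
    by simp
  then have "kxy.span (v ` {..<s}) = V"
    by (intro kxy.subspace_eq_of_dim_ge[OF forms_finite(1) order_trans[OF V(2) forms_finite(2)] sub])
      simp_all
  then show ?thesis using v by (intro exI[of _ v]) auto
qed

text \<open>
  Bases in echelon form with leading coefficients \<open>1\<close> can be combined, since the leading coefficient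
  \<open>(1 - l) + l = 1\<close> persists along the line.
\<close>

lemma line_connected_cell:
  assumes S: "S \<subseteq> {..d}"
  shows "line_connected (card S)
    {V :: 'k::field kxy set. kxy.subspace V \<and> V \<subseteq> forms d \<and> leads d V = S}"
  unfolding line_connected_def
proof (intro ballI)
  let ?s = "card S"
  fix V W :: "'k kxy set"
  assume V: "V \<in> {V. kxy.subspace V \<and> V \<subseteq> forms d \<and> leads d V = S}"
    and W: "W \<in> {V. kxy.subspace V \<and> V \<subseteq> forms d \<and> leads d V = S}"
  have "finite S" using S finite_subset by blast
  then obtain e where e: "bij_betw e {..<?s} S"
    using ex_bij_betw_nat_finite[of S] by (auto simp: lessThan_atLeast0)
  obtain v where v: "V = kxy.span (v ` {..<?s})"
    "\<forall>j<?s. v j \<in> low_forms d (Suc (e j)) \<and> coeff_y d (v j) (e j) = 1"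
    using exists_echelon_basis[of V d e ?s] V e by auto
  obtain w where w: "W = kxy.span (w ` {..<?s})"
    "\<forall>j<?s. w j \<in> low_forms d (Suc (e j)) \<and> coeff_y d (w j) (e j) = 1"
    using exists_echelon_basis[of W d e ?s] W e by auto
  have "kxy.span ((\<lambda>j. scalar (1 - l) (v j) + scalar l (w j)) ` {..<?s})
      \<in> {V. kxy.subspace V \<and> V \<subseteq> forms d \<and> leads d V = S}" for l
  proof -
    let ?u = "\<lambda>j. scalar (1 - l) (v j) + scalar l (w j)"
    have u: "?u j \<in> low_forms d (Suc (e j)) \<and> coeff_y d (?u j) (e j) \<noteq> 0" if "j < ?s" for j
    proof
      show "?u j \<in> low_forms d (Suc (e j))"
        using v(2) w(2) that
        by (intro kxy.subspace_add kxy.subspace_scale subspace_low_forms) auto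
      show "coeff_y d (?u j) (e j) \<noteq> 0" using v(2) w(2) that by (simp add: lookup_add)
    qed
    have "?u j \<in> forms d" if "j < ?s" for j
      using u[OF that] low_forms_subset_forms by blast
    then have "kxy.span (?u ` {..<?s}) \<subseteq> forms d"
      by (intro kxy.span_minimal[OF _ subspace_forms]) auto
    then show ?thesis using leads_span_echelon[of e ?s S d ?u, OF e S u] by simp
  qed
  then show "\<exists>v w. V = kxy.span (v ` {..<?s}) \<and> W = kxy.span (w ` {..<?s}) \<and>
     (\<forall>l. let u = (\<lambda>j. scalar (1 - l) (v j) + scalar l (w j)) in independent_family ?s u \<longrightarrow>
       kxy.span (u ` {..<?s}) \<in> {V. kxy.subspace V \<and> V \<subseteq> forms d \<and> leads d V = S})"
    unfolding Let_def using v(1) w(1) by (intro exI[of _ v] exI[of _ w] conjI allI impI) simp_all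
qed

lemma line_connected_all:
  "line_connected s {V :: 'k::field kxy set. kxy.subspace V \<and> V \<subseteq> forms d \<and> kxy.dim V = s}"
  unfolding line_connected_def
proof (intro ballI)
  let ?A = "{V :: 'k kxy set. kxy.subspace V \<and> V \<subseteq> forms d \<and> kxy.dim V = s}"
  have basis: "\<exists>v. V = kxy.span (v ` {..<s}) \<and> (\<forall>j<s. v j \<in> forms d)" if V: "V \<in> ?A" for V
  proof -
    have sub: "kxy.subspace V" "V \<subseteq> forms d" and dim: "kxy.dim V = s" using V by auto
    have "V \<subseteq> kxy.span (form_monomial d ` {..<Suc d})"
      using sub(2) forms_finite(2) by (rule order_trans)
    then obtain B where B: "B \<subseteq> V" "V \<subseteq> kxy.span B" "card B = s" "finite B"
      using kxy.finite_basis_obtain[OF forms_finite(1)] dim by metis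
    obtain v where v: "bij_betw v {..<s} B"
      using ex_bij_betw_nat_finite[OF B(4)] B(3) by (auto simp: lessThan_atLeast0)
    have "kxy.span B = V" using B(1,2) kxy.span_minimal[OF B(1) sub(1)] by blast
    moreover have "v ` {..<s} = B" using v by (simp add: bij_betw_def)
    moreover have "\<forall>j<s. v j \<in> forms d" using \<open>v ` {..<s} = B\<close> B(1) sub(2) by blast
    ultimately show ?thesis by (intro exI[of _ v]) simp
  qed
  fix V W assume V: "V \<in> ?A" and W: "W \<in> ?A"
  obtain v where v: "V = kxy.span (v ` {..<s})" "\<forall>j<s. v j \<in> forms d" using basis[OF V] by blast
  obtain w where w: "W = kxy.span (w ` {..<s})" "\<forall>j<s. w j \<in> forms d" using basis[OF W] by blast
  have "kxy.span (u ` {..<s}) \<in> ?A"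
    if u: "independent_family s u" "u = (\<lambda>j. scalar (1 - l) (v j) + scalar l (w j))" for u l
  proof -
    have "u j \<in> forms d" if "j < s" for j
      unfolding u(2) using v(2) w(2) that
      by (intro kxy.subspace_add kxy.subspace_scale subspace_forms) auto
    then have "kxy.span (u ` {..<s}) \<subseteq> forms d"
      by (intro kxy.span_minimal[OF _ subspace_forms]) auto
    then show ?thesis using u(1) by (simp add: independent_family_iff_dim)
  qed
  then show "\<exists>v w. V = kxy.span (v ` {..<s}) \<and> W = kxy.span (w ` {..<s}) \<and>
     (\<forall>l. let u = (\<lambda>j. scalar (1 - l) (v j) + scalar l (w j)) in independent_family s u \<longrightarrow>
       kxy.span (u ` {..<s}) \<in> ?A)"
    unfolding Let_def using v(1) w(1) by (intro exI[of _ v] exI[of _ w] conjI allI impI) simp_all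
qed

lemma linear_multiples_gap_le:
  assumes V: "kxy.subspace V" "V \<subseteq> forms d"
  shows "kxy.dim (linear_multiples V) + gap (leads d V) (Suc d) \<le> d + 2"
proof -
  have "V \<inter> low_forms d (Suc d) = V" using V(2) by (auto simp: forms_eq_low_forms)
  then show ?thesis using dim_linear_multiples_le[OF V(1), of "Suc d" d] by simp
qed

lemma exists_linear_multiples_gap_eq:
  assumes S: "S \<subseteq> {..d}"
  shows "\<exists>V :: 'k::field kxy set. kxy.subspace V \<and> V \<subseteq> forms d \<and> leads d V = S \<and>
    kxy.dim (linear_multiples V) + gap S (Suc d) = d + 2"
proof -
  have "S \<inter> {..<Suc d} = S" using S by auto
  then show ?thesis
    using exists_dim_linear_multiples_eq[of "Suc d" d S, where ?'k = 'k]
    by (simp add: forms_eq_low_forms del: gap.simps)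
qed

lemma kappa_partition_eq:
  fixes K :: "'k::field itself"
  assumes inf: "infinite (UNIV :: 'k set)"
    and P: "is_partition P" and C: "C_mon P = staircase d (E_exponents d P)"
  shows "kappa_partition K P = card (E_exponents d P) + gap (E_exponents d P) (Suc d)"
proof -
  let ?S = "E_exponents d P"
  let ?A = "{V :: 'k kxy set. kxy.subspace V \<and> V \<subseteq> forms d \<and> leads d V = ?S}"
  have S: "?S \<subseteq> {..d}" by (auto simp: E_exponents_def)
  obtain V :: "'k kxy set" where V: "V \<in> ?A" "kxy.dim (linear_multiples V) + gap ?S (Suc d) = d + 2"
    using exists_linear_multiples_gap_eq[OF S, where ?'k = 'k] by blast
  have max: "kxy.dim (linear_multiples W) \<le> kxy.dim (linear_multiples V)" if "W \<in> ?A" for W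
    using linear_multiples_gap_le[of W d] that V(2) by (simp del: gap.simps)
  have "generic_value (ideal_of_forms d ` ?A) min_gens
      = card ?S + d + 2 - kxy.dim (linear_multiples V)"
    using max V(1)
    by (intro generic_min_gens[OF inf _ line_connected_cell[OF S]]) (auto simp: dim_eq_card_leads)
  then show ?thesis
    unfolding kappa_partition_def jordan_cell_eq[OF P C] using V(2) by simp
qed

lemma gap_ge: "m + 1 \<le> gap S m + 2 * card (S \<inter> {..<m})"
  by (induction m) (auto simp: lessThan_Suc)

lemma gap_interval:
  assumes "k \<le> s"
  shows "gap {t..<t + s} (t + k) = t + 1 - k"
  using assms
proof (induction k)
  case 0
  have "gap {t..<t + s} m = m + 1" if "m \<le> t" for m using that by (induction m) auto
  then show ?case by simp
next
  case (Suc k)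
  then show ?case by auto
qed

text \<open>
  The whole variety is treated like a cell. The gap is smallest for the cell whose exponents come
  last, when the walk first goes up \<open>t\<close> times and then down \<open>s\<close> times.
\<close>

lemma kappa_hilbert_eq:
  fixes K :: "'k::field itself"
  assumes inf: "infinite (UNIV :: 'k set)" and t: "t \<le> d"
    and T: "T = (\<lambda>i. if i < d then i + 1 else if i = d then t else 0)"
    and s: "s = Suc d - t"
  shows "kappa_hilbert K T = s + (t + 1 - s)"
proof -
  let ?A = "{V :: 'k kxy set. kxy.subspace V \<and> V \<subseteq> forms d \<and> kxy.dim V = s}"
  let ?S = "{t..<t + s}"
  have ts: "t + s = Suc d" using t s by simp
  have S: "?S \<subseteq> {..d}" using ts by auto
  have gap: "gap ?S (Suc d) = t + 1 - s" using gap_interval[of s s t] ts by simp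
  obtain V :: "'k kxy set" where V: "kxy.subspace V" "V \<subseteq> forms d" "leads d V = ?S"
    "kxy.dim (linear_multiples V) + gap ?S (Suc d) = d + 2"
    using exists_linear_multiples_gap_eq[OF S, where ?'k = 'k] by blast
  have VA: "V \<in> ?A" using V(1-3) by (simp add: dim_eq_card_leads)
  have max: "kxy.dim (linear_multiples W) \<le> kxy.dim (linear_multiples V)" if "W \<in> ?A" for W
  proof -
    have W: "kxy.subspace W" "W \<subseteq> forms d" "card (leads d W) = s"
      using that by (auto simp: dim_eq_card_leads)
    have "leads d W \<inter> {..<Suc d} = leads d W" using leads_subset[of d W] by auto
    then have "t + 1 - s \<le> gap (leads d W) (Suc d)"
      using gap_ge[of "Suc d" "leads d W"] W(3) ts by (simp del: gap.simps)
    then show ?thesis using linear_multiples_gap_le[OF W(1,2)] V(4) unfolding gap by linarith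
  qed
  have "generic_value (ideal_of_forms d ` ?A) min_gens
      = s + d + 2 - kxy.dim (linear_multiples V)"
    using max VA by (intro generic_min_gens[OF inf _ line_connected_all]) auto
  then show ?thesis
    unfolding kappa_hilbert_def G_var_eq[OF t T] s[symmetric] using V(4) gap by simp
qed

section \<open>Counting the walks\<close>

text \<open>An exponent \<open>n\<close> is read only by the step from \<open>n\<close> to \<open>n + 1\<close>.\<close>

lemma gap_insert: "m \<le> n \<Longrightarrow> gap (insert n S) m = gap S m"
  by (induction m) auto

text \<open>
  For \<open>h > 0\<close> the last step is either up, from a value at least \<open>h - 1\<close>, or down, from a value at
  least \<open>h + 1\<close>, and the two numbers add up by Pascal's rule. The value \<open>0\<close>, where the walk is held
  back, matters only for \<open>h = 0\<close>, and then all subsets are counted. With \<open>n = s + t\<close> the assumption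
  reads \<open>h > t + 1 - s\<close>, and both terms inherit it.
\<close>

lemma card_gap_ge:
  assumes "n + 2 \<le> h + 2 * s"
  shows "card {S. S \<subseteq> {..<n} \<and> card S = s \<and> h \<le> gap S n} = n choose (s + h)"
  using assms
proof (induction n arbitrary: s h)
  case 0
  then have "{S. S \<subseteq> {..<0 :: nat} \<and> card S = s \<and> h \<le> gap S 0} = {}" by auto
  moreover have "0 < s + h" using 0 by linarith
  ultimately show ?case by (simp only: card.empty binomial_eq_0)
next
  case (Suc n)
  let ?N = "\<lambda>n s h. {S. S \<subseteq> {..<n :: nat} \<and> card S = s \<and> h \<le> gap S n}"
  show ?case
  proof (cases h)
    case 0
    then show ?thesis by (simp add: n_subsets)
  next
    case (Suc h')
    let ?D = "{S \<in> ?N (Suc n) s h. n \<in> S}"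
    have fin: "finite (?N n s h)" for n s h
      by (rule finite_subset[of _ "Pow {..<n}"]) auto
    have out: "{S \<in> ?N (Suc n) s h. n \<notin> S} = ?N n s h'"
      using Suc by (auto simp: lessThan_Suc)
    have inn: "card ?D = n choose (s + h)"
    proof (cases s)
      case 0
      have "S \<notin> ?D" for S
      proof
        assume S: "S \<in> ?D"
        then have "finite S" using finite_subset[of S "{..<Suc n}"] by simp
        then show False using S 0 by auto
      qed
      then have "?D = {}" by blast
      then show ?thesis using 0 Suc.prems by (simp only: card.empty) simp
    next
      case (Suc s')
      have "?D = insert n ` ?N n s' (Suc h)"
      proof (intro equalityI subsetI)
        fix S assume S: "S \<in> ?D"
        then have fS: "finite S" using finite_subset[of S "{..<Suc n}"] by simp
        let ?S = "S - {n}"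
        have ins: "S = insert n ?S" using S by auto
        have "gap S n = gap ?S n" using gap_insert[of n n ?S] ins by simp
        then have "?S \<in> ?N n s' (Suc h)"
          using S fS Suc \<open>h = Suc h'\<close> by (auto simp: lessThan_Suc)
        then show "S \<in> insert n ` ?N n s' (Suc h)" using ins by blast
      next
        fix S assume "S \<in> insert n ` ?N n s' (Suc h)"
        then obtain S' where S': "S = insert n S'" "S' \<in> ?N n s' (Suc h)" by blast
        then have "finite S'" "n \<notin> S'" using finite_subset[of S' "{..<n}"] by auto
        then show "S \<in> ?D" using S' Suc gap_insert[of n n S'] by (auto simp: lessThan_Suc)
      qed
      moreover have "inj_on (insert n) (?N n s' (Suc h))"
        by (rule inj_onI) (metis (no_types, lifting) Diff_insert_absorb insert_absorb lessThan_iff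
            less_irrefl mem_Collect_eq subsetD)
      ultimately have "card ?D = card (?N n s' (Suc h))" by (simp add: card_image)
      also have "\<dots> = n choose (s' + Suc h)"
        using Suc.prems Suc by (intro Suc.IH) simp
      finally show ?thesis using Suc by simp
    qed
    have "?N (Suc n) s h = {S \<in> ?N (Suc n) s h. n \<notin> S} \<union> ?D" by blast
    then have "card (?N (Suc n) s h) = card {S \<in> ?N (Suc n) s h. n \<notin> S} + card ?D"
      using fin[of "Suc n" s h] by (subst card_Un_disjoint[symmetric]) auto
    also have "\<dots> = (n choose (s + h')) + (n choose (s + h))"
      unfolding out inn using Suc.IH[of h' s] Suc.prems Suc by simp
    also have "\<dots> = Suc n choose (s + h)" using Suc by simp
    finally show ?thesis .
  qed
qed

section \<open>Partitions with given diagonal lengths\<close>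

lemma partition_eqI:
  assumes P: "is_partition P" and Q: "is_partition Q" and C: "C_mon P = C_mon Q"
  shows "P = Q"
proof -
  have len: "b < length P' \<longleftrightarrow> (0, b) \<in> C_mon P'" if "is_partition P'" for P' b
    using that by (auto simp: C_mon_def is_partition_def)
  have "length P = length Q" using len[OF P] len[OF Q] C by (metis less_irrefl nat_neq_iff)
  moreover have "P ! b = Q ! b" if "b < length P" for b
  proof -
    have "a < P ! b \<longleftrightarrow> a < Q ! b" for a
    proof -
      have "(a, b) \<in> C_mon P \<longleftrightarrow> (a, b) \<in> C_mon Q" using C by simp
      then show ?thesis using that \<open>length P = length Q\<close> by (simp add: C_mon_def)
    qed
    then show ?thesis by (metis less_irrefl nat_neq_iff)
  qed
  ultimately show ?thesis by (rule nth_equalityI)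
qed

text \<open>
  Row \<open>b\<close> of the staircase has length \<open>d - b\<close> or \<open>d + 1 - b\<close>. The row \<open>b = d\<close> is empty if \<open>d\<close> is in
  \<open>S\<close>, and must then be left out, as parts are positive.
\<close>

lemma exists_staircase_partition:
  assumes S: "S \<subseteq> {..d}"
  shows "\<exists>P. is_partition P \<and> C_mon P = staircase d S"
proof -
  define p where "p b = (if b \<in> S then d - b else Suc d - b)" for b
  define P where "P = map p [0..<(if d \<in> S then d else Suc d)]"
  have len: "b < length P \<longleftrightarrow> b \<le> d \<and> 0 < p b" for b
    by (auto simp: P_def p_def less_Suc_eq)
  have nth: "P ! b = p b" if "b < length P" for b using that by (simp add: P_def)
  have "is_partition P"
    unfolding is_partition_def
  proof
    show "sorted_wrt (\<ge>) P"
      unfolding sorted_wrt_iff_nth_less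
    proof (intro allI impI)
      fix i j assume ij: "i < j" "j < length P"
      then show "P ! j \<le> P ! i" using nth[of i] nth[of j] by (auto simp: p_def)
    qed
    show "\<forall>x\<in>set P. 0 < x" using len nth by (auto simp: in_set_conv_nth)
  qed
  moreover have "(a, b) \<in> C_mon P \<longleftrightarrow> (a, b) \<in> staircase d S" for a b
  proof -
    have "(a, b) \<in> C_mon P \<longleftrightarrow> b \<le> d \<and> a < p b"
      unfolding C_mon_def using len[of b] nth[of b] by auto
    also have "\<dots> \<longleftrightarrow> (a, b) \<in> staircase d S" by (auto simp: p_def staircase_def)
    finally show ?thesis .
  qed
  then have "C_mon P = staircase d S" by auto
  ultimately show ?thesis by blast
qed

lemma E_exponents_staircase: "S \<subseteq> {..d} \<Longrightarrow> C_mon P = staircase d S \<Longrightarrow> E_exponents d P = S"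
  by (auto simp: E_exponents_def staircase_def)

lemma bij_betw_E_exponents:
  fixes K :: "'k::field itself"
  assumes t: "t \<le> d" and T: "T = (\<lambda>i. if i < d then i + 1 else if i = d then t else 0)"
  shows "bij_betw (E_exponents d) (partitions_of_diag K T) {S. S \<subseteq> {..<Suc d} \<and> card S = Suc d - t}"
  unfolding bij_betw_def
proof
  note iff = partitions_of_diag_iff[OF t T, of _ K]
  show "inj_on (E_exponents d) (partitions_of_diag K T)"
    by (rule inj_onI) (metis iff partition_eqI)
  show "E_exponents d ` partitions_of_diag K T = {S. S \<subseteq> {..<Suc d} \<and> card S = Suc d - t}"
  proof (intro equalityI subsetI)
    fix S assume "S \<in> E_exponents d ` partitions_of_diag K T"
    then show "S \<in> {S. S \<subseteq> {..<Suc d} \<and> card S = Suc d - t}"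
      using iff by (auto simp: E_exponents_def)
  next
    fix S assume "S \<in> {S. S \<subseteq> {..<Suc d} \<and> card S = Suc d - t}"
    then have S: "S \<subseteq> {..d}" "card S = Suc d - t" by auto
    obtain P where P: "is_partition P" "C_mon P = staircase d S"
      using exists_staircase_partition[OF S(1)] by blast
    have "E_exponents d P = S" using E_exponents_staircase[OF S(1) P(2)] .
    then show "S \<in> E_exponents d ` partitions_of_diag K T"
      using P S(2) iff by (intro image_eqI[of _ _ P]) auto
  qed
qed

text \<open>
  As \<open>\<kappa>(P)\<close> is \<open>s\<close> plus the final value of the walk of \<open>P\<close>, the condition \<open>\<kappa>(P) \<ge> k\<close> asks for a
  final value at least \<open>h = k - s\<close>. Special partitions are the case \<open>h = \<delta> + 1\<close>, since the smallest
  final value is \<open>\<delta>\<close>.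
\<close>

theorem theorem4p2:
  fixes K :: "'k::field itself"
    and T :: "nat \<Rightarrow> nat"
    and d t :: nat
    and s \<delta> :: int
  assumes field: "CHAR('k) = 0 \<or> (infinite (UNIV :: 'k set) \<and> CHAR('k) > d)"
    and t: "1 \<le> t" "t \<le> d"
    and T: "T = (\<lambda>i. if i < d then i + 1 else if i = d then t else 0)"
    and s: "s = int d + 1 - int t"
    and \<delta>: "\<delta> = max (int t + 1 - s) 0"
  shows "finite (partitions_of_diag K T)
    \<and> (\<forall>k::int. s + \<delta> < k \<and> k \<le> s + int t \<longrightarrow>
         card {P \<in> partitions_of_diag K T. int (kappa_partition K P) \<ge> k} = binom (s + int t) k)
    \<and> card {P \<in> partitions_of_diag K T. special K T P} = binom (s + int t) (s + \<delta> + 1)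
    \<and> binom (s + int t) (s + \<delta> + 1) = binom (s + int t) (min (s - 2) (int t - 1))
    \<and> int (card {P \<in> partitions_of_diag K T. \<not> special K T P})
        = int (binom (s + int t) s) - int (binom (s + int t) (s + \<delta> + 1))"
proof -
  let ?\<P> = "partitions_of_diag K T"
  define n where "n = Suc d"
  define s' where "s' = n - t"
  define \<delta>' where "\<delta>' = t + 1 - s'"
  have nt: "n = s' + t" and s'1: "1 \<le> s'" using t by (simp_all add: s'_def n_def)
  have ints: "s = int s'" "\<delta> = int \<delta>'" using t by (auto simp: s \<delta> s'_def n_def \<delta>'_def)
  have inf: "infinite (UNIV :: 'k set)" using field finite_imp_CHAR_pos[where ?'a = 'k] by auto
  have bij: "bij_betw (E_exponents d) ?\<P> {S. S \<subseteq> {..<n} \<and> card S = s'}"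
    using bij_betw_E_exponents[OF t(2) T, of K] by (simp only: n_def s'_def)
  have kappa: "kappa_partition K P = s' + gap (E_exponents d P) n" if "P \<in> ?\<P>" for P
    using that kappa_partition_eq[OF inf, of P d K] partitions_of_diag_iff[OF t(2) T, of P K]
    by (simp add: n_def s'_def del: gap.simps)
  have kappaT: "kappa_hilbert K T = s' + \<delta>'"
    using kappa_hilbert_eq[OF inf t(2) T refl, of K] by (simp add: n_def s'_def \<delta>'_def)
  have finS: "finite {S. S \<subseteq> {..<n} \<and> card S = s'}"
    by (rule finite_subset[of _ "Pow {..<n}"]) auto
  have fin: "finite ?\<P>" using bij_betw_finite[OF bij] finS by blast
  have cardP: "card ?\<P> = n choose s'"
    using bij_betw_same_card[OF bij] n_subsets[of "{..<n}" s'] by simp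
  have count: "card {P \<in> ?\<P>. s' + h \<le> kappa_partition K P} = n choose (s' + h)" if h: "\<delta>' < h" for h
  proof -
    have "bij_betw (E_exponents d) {P \<in> ?\<P>. s' + h \<le> kappa_partition K P}
        {S. S \<subseteq> {..<n} \<and> card S = s' \<and> h \<le> gap S n}"
      unfolding bij_betw_def
    proof
      show "inj_on (E_exponents d) {P \<in> ?\<P>. s' + h \<le> kappa_partition K P}"
        using bij by (auto simp: bij_betw_def intro: inj_on_subset)
      have "E_exponents d ` {P \<in> ?\<P>. s' + h \<le> kappa_partition K P}
          = {S \<in> E_exponents d ` ?\<P>. h \<le> gap S n}"
        using kappa by auto
      also have "E_exponents d ` ?\<P> = {S. S \<subseteq> {..<n} \<and> card S = s'}"
        using bij by (simp add: bij_betw_def)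
      finally show "E_exponents d ` {P \<in> ?\<P>. s' + h \<le> kappa_partition K P}
          = {S. S \<subseteq> {..<n} \<and> card S = s' \<and> h \<le> gap S n}" by auto
    qed
    then have "card {P \<in> ?\<P>. s' + h \<le> kappa_partition K P}
        = card {S. S \<subseteq> {..<n} \<and> card S = s' \<and> h \<le> gap S n}" by (rule bij_betw_same_card)
    also have "\<dots> = n choose (s' + h)"
      using h nt by (intro card_gap_ge) (auto simp: \<delta>'_def)
    finally show ?thesis .
  qed
  have binom: "binom (s + int t) (int k) = n choose k" for k
    by (simp add: binom_def ints nt flip: of_nat_add)
  have special: "special K T P \<longleftrightarrow> s' + Suc \<delta>' \<le> kappa_partition K P" if "P \<in> ?\<P>" for P
  proof -
    have "E_exponents d P \<in> {S. S \<subseteq> {..<n} \<and> card S = s'}"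
      using bij_betwE[OF bij] that by blast
    then have "E_exponents d P \<inter> {..<n} = E_exponents d P" "card (E_exponents d P) = s'" by auto
    then have "\<delta>' \<le> gap (E_exponents d P) n"
      using gap_ge[of n "E_exponents d P"] nt by (simp add: \<delta>'_def)
    then show ?thesis by (auto simp: special_def kappa[OF that] kappaT)
  qed
  have "{P \<in> ?\<P>. special K T P} = {P \<in> ?\<P>. s' + Suc \<delta>' \<le> kappa_partition K P}"
    using special by blast
  then have cards: "card {P \<in> ?\<P>. special K T P} = n choose (s' + Suc \<delta>')"
    using count[of "Suc \<delta>'"] by simp
  have b1: "binom (s + int t) (s + \<delta> + 1) = n choose (s' + Suc \<delta>')"
    using binom[of "s' + Suc \<delta>'"] by (simp add: ints algebra_simps)
  show ?thesis
  proof (intro conjI allI impI)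
    show "finite ?\<P>" by (rule fin)
  next
    fix k :: int assume k: "s + \<delta> < k \<and> k \<le> s + int t"
    then obtain h where h: "k = int (s' + h)" "\<delta>' < h"
      using that[of "nat (k - s)"] by (auto simp: ints)
    have "{P \<in> ?\<P>. k \<le> int (kappa_partition K P)} = {P \<in> ?\<P>. s' + h \<le> kappa_partition K P}"
      unfolding h(1) of_nat_le_iff ..
    then show "card {P \<in> ?\<P>. k \<le> int (kappa_partition K P)} = binom (s + int t) k"
      using count[OF h(2)] binom[of "s' + h"] h(1) by simp
  next
    show "card {P \<in> ?\<P>. special K T P} = binom (s + int t) (s + \<delta> + 1)"
      unfolding cards b1 ..
  next
    show "binom (s + int t) (s + \<delta> + 1) = binom (s + int t) (min (s - 2) (int t - 1))"
    proof (cases "s' = 1")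
      case True
      then show ?thesis unfolding b1 using nt by (simp add: binom_def ints \<delta>'_def)
    next
      case False
      then have m: "min (s - 2) (int t - 1) = int (n - (s' + Suc \<delta>'))" and le: "s' + Suc \<delta>' \<le> n"
        using s'1 t nt by (auto simp: ints \<delta>'_def)
      show ?thesis unfolding b1 m binom by (rule binomial_symmetric[OF le])
    qed
  next
    have "?\<P> = {P \<in> ?\<P>. special K T P} \<union> {P \<in> ?\<P>. \<not> special K T P}" by blast
    then have "card ?\<P> = card {P \<in> ?\<P>. special K T P} + card {P \<in> ?\<P>. \<not> special K T P}"
      using fin by (subst card_Un_disjoint[symmetric]) auto
    moreover have "binom (s + int t) s = n choose s'" using binom[of s'] by (simp add: ints)
    ultimately show "int (card {P \<in> ?\<P>. \<not> special K T P})
        = int (binom (s + int t) s) - int (binom (s + int t) (s + \<delta> + 1))"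
      unfolding b1 using cards cardP by simp
  qed
qed

end
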